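(* Let $n\ge2$ and let $\Phi\colon M_n(\mathbb C)\to M_n(\mathbb C)$ be a BJ isomorphism. Then there exists a function $\gamma\colon M_n(\mathbb C)\to\mathbb C\setminus\{0\}$ such that the map $X\mapsto\gamma(X)\Phi(X)$ is a linear or conjugate-linear isometry of $M_n(\mathbb C)$.
   Context: $M_n(\mathbb C)$ carries the operator (spectral) norm. For $A,B$ in a complex normed space, $A\perp B$ (Birkhoff–James orthogonality) means $\|A+\lambda B\|\ge\|A\|$ for all $\lambda\in\mathbb C$. A BJ isomorphism is a bijective map $\Phi$ such that $A\perp B$ if and only if $\Phi(A)\perp\Phi(B)$. *)

theory Defs
  imports "HOL-Analysis.Analysis"
begin

text \<open>Complex n x n matrices are modelled as complex^'n^'n (n = CARD('n)).
  Vectors complex^'n carry the Euclidean (l2) norm, so the operator norm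
  below is the spectral norm.\<close>

definition opnorm :: "complex^'n^'n \<Rightarrow> real" where
  "opnorm A = onorm (\<lambda>x. A *v x)"

definition msmul :: "complex \<Rightarrow> complex^'n^'n \<Rightarrow> complex^'n^'n" where
  "msmul c A = (\<chi> i j. c * A $ i $ j)"

definition bj_orth :: "complex^'n^'n \<Rightarrow> complex^'n^'n \<Rightarrow> bool" where
  "bj_orth A B \<longleftrightarrow> (\<forall>t::complex. opnorm (A + msmul t B) \<ge> opnorm A)"

end

theory Submission
  imports Defs
begin

text \<open>Birkhoff--James orthogonality determines which matrices attain their norm on two
  orthogonal vectors (those dominated by some \<open>C\<close> with \<open>A \<perp> C\<close>), and rank-one matrices are the
  nonzero matrices to which all of these are orthogonal. Hence \<open>\<Phi>\<close> permutes the rank-one matrices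
  \<open>x y\<^sup>*\<close>, and since \<open>x y\<^sup>* \<perp> B\<close> means \<open>\<langle>x, B y\<rangle> = 0\<close>, orthogonality among them determines when two
  share a factor. So, up to adjoints, \<open>\<Phi> (x y\<^sup>*)\<close> is proportional to \<open>f x (g y)\<^sup>*\<close>, and
  \<open>\<langle>x, B y\<rangle> = 0\<close> iff \<open>\<langle>f x, \<Phi> B (g y)\<rangle> = 0\<close>. Taking \<open>B = I\<close> expresses \<open>g\<close> by \<open>f\<close> up to a unitary,
  and then \<open>f\<close> intertwines every matrix with some matrix on the level of lines. As in the fundamental
  theorem of projective geometry \<open>f\<close> is semilinear; preservation of orthogonality makes its linear
  part a multiple of a unitary and makes its field homomorphism commute with conjugation, so it is
  the identity or the conjugation. Finally \<open>\<Phi> B\<close> is determined up to a scalar by the zeros of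
  \<open>\<langle>f x, \<Phi> B (g y)\<rangle>\<close>.\<close>

section \<open>The Hermitian inner product\<close>

text \<open>\<open>\<Phi>\<close> comes with no additivity or continuity, and Birkhoff-James
  orthogonality is not symmetric. What \<open>\<Phi>\<close> transports for certain is whatever can
  be phrased with quantifiers over matrices and \<open>bj_orth\<close> alone; hence smoothness, rank
  one, proportionality and sharing a factor are each recast in that language before
  \<open>\<Phi>\<close> is applied to them. For n = 2 the projective space is a line, where
  collinearity carries no information, so the classical argument from lines to a field homomorphism
  has nothing to start from. The intertwining relation with all matrices takes its place: shears
  give additivity of the coordinate function and diagonal matrices its multiplicativity, in every
  dimension n >= 2 alike. Images of vectors are known only up to scalars throughout. The remaining
  scalars are fixed by comparing two columns of the same matrix \<open>\<Psi> B\<close>, whose ratio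
  does not depend on the vector it is applied to.\<close>

definition cinner :: "complex^'n \<Rightarrow> complex^'n \<Rightarrow> complex" where
  "cinner x y = (\<Sum>i\<in>UNIV. cnj (x$i) * y$i)"

definition adjoint_mat :: "complex^'n^'n \<Rightarrow> complex^'n^'n" where
  "adjoint_mat A = (\<chi> i j. cnj (A$j$i))"

definition rank_one :: "complex^'n \<Rightarrow> complex^'n \<Rightarrow> complex^'n^'n" where
  "rank_one a b = (\<chi> i j. a$i * cnj (b$j))"

text \<open>Asking for a nonzero factor makes this an equivalence relation in which 0 forms a class
  of its own, so statements about lines extend to vectors that may vanish.\<close>

definition par :: "complex^'n \<Rightarrow> complex^'n \<Rightarrow> bool" where
  "par x y \<longleftrightarrow> (\<exists>c. c \<noteq> 0 \<and> y = c *s x)"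

lemma cinner_simps:
  "cinner (x + y) z = cinner x z + cinner y z"
  "cinner x (y + z) = cinner x y + cinner x z"
  "cinner (x - y) z = cinner x z - cinner y z"
  "cinner x (y - z) = cinner x y - cinner x z"
  "cinner (c *s x) y = cnj c * cinner x y"
  "cinner x (c *s y) = c * cinner x y"
  "cinner 0 y = 0"
  "cinner x 0 = 0"
  "cinner (- x) y = - cinner x y"
  "cinner x (- y) = - cinner x y"
  by (simp_all add: cinner_def algebra_simps sum.distrib sum_subtractf sum_distrib_left sum_negf)

lemma cnj_cinner: "cnj (cinner x y) = cinner y x"
  by (simp add: cinner_def mult.commute)

lemma cinner_eq_0_commute: "cinner x y = 0 \<longleftrightarrow> cinner y x = 0"
  by (metis cnj_cinner complex_cnj_zero_iff)

lemma cinner_self: "cinner x x = of_real ((norm x)\<^sup>2)"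
proof -
  have "(norm x)\<^sup>2 = (\<Sum>i\<in>UNIV. (cmod (x$i))\<^sup>2)"
    by (simp add: norm_vec_def L2_set_def sum_nonneg)
  then show ?thesis
    by (simp add: cinner_def complex_norm_square mult.commute del: of_real_power)
qed

lemma cinner_self_eq_0: "cinner x x = 0 \<longleftrightarrow> x = 0"
  by (simp add: cinner_self)

lemma norm_sq_eq_cinner: "(norm x)\<^sup>2 = Re (cinner x x)"
  by (simp add: cinner_self)

lemma norm_vector_smult: "norm (c *s (x::complex^'n)) = cmod c * norm x"
proof -
  have "cinner (c *s x) (c *s x) = c * cnj c * cinner x x"
    by (simp add: cinner_simps)
  then have "complex_of_real ((norm (c *s x))\<^sup>2) = of_real ((cmod c * norm x)\<^sup>2)"
    unfolding cinner_self power_mult_distrib of_real_mult complex_norm_square .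
  then have "(norm (c *s x))\<^sup>2 = (cmod c * norm x)\<^sup>2"
    using of_real_eq_iff by blast
  then show ?thesis by (simp add: power2_eq_iff_nonneg)
qed

lemma norm_add_sq: "(norm (x + y))\<^sup>2 = (norm x)\<^sup>2 + (norm y)\<^sup>2 + 2 * Re (cinner x y)"
proof -
  have "Re (cinner y x) = Re (cinner x y)"
    by (metis cnj_cinner cnj.sel(1))
  then show ?thesis
    by (simp add: norm_sq_eq_cinner cinner_simps)
qed

lemma norm_add_sq_orth:
  assumes "cinner x y = 0"
  shows "(norm (x + y))\<^sup>2 = (norm x)\<^sup>2 + (norm y)\<^sup>2"
  by (simp add: norm_add_sq assms)

lemma cinner_axis_left [simp]: "cinner (axis i 1) y = y$i"
proof -
  have "cinner (axis i 1) y = (\<Sum>j\<in>UNIV. if j = i then y$j else 0)"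
    unfolding cinner_def by (rule sum.cong) (auto simp: axis_def)
  then show ?thesis by simp
qed

lemma cinner_axis_right [simp]: "cinner y (axis i 1) = cnj (y$i)"
  by (metis cinner_axis_left cnj_cinner)

lemma cinner_right_eqI:
  assumes "\<And>z. cinner z x = cinner z y"
  shows "x = y"
  by (metis assms cinner_axis_left vec_eq_iff)

lemma cinner_adjoint: "cinner x (A *v y) = cinner (adjoint_mat A *v x) y"
proof -
  have "cinner x (A *v y) = (\<Sum>i\<in>UNIV. \<Sum>j\<in>UNIV. cnj (x$i) * A$i$j * y$j)"
    by (simp add: cinner_def matrix_vector_mult_def sum_distrib_left mult_ac)
  also have "\<dots> = (\<Sum>j\<in>UNIV. \<Sum>i\<in>UNIV. cnj (x$i) * A$i$j * y$j)"
    by (rule sum.swap)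
  also have "\<dots> = cinner (adjoint_mat A *v x) y"
    by (simp add: cinner_def matrix_vector_mult_def adjoint_mat_def sum_distrib_right
        sum_distrib_left mult_ac)
  finally show ?thesis .
qed

lemma adjoint_adjoint [simp]: "adjoint_mat (adjoint_mat A) = A"
  by (simp add: adjoint_mat_def vec_eq_iff)

lemma cinner_adjoint_left: "cinner (A *v x) y = cinner x (adjoint_mat A *v y)"
  by (simp add: cinner_adjoint)

lemma adjoint_add: "adjoint_mat (A + B) = adjoint_mat A + adjoint_mat B"
  by (simp add: adjoint_mat_def vec_eq_iff)

lemma adjoint_msmul: "adjoint_mat (msmul c A) = msmul (cnj c) (adjoint_mat A)"
  by (simp add: adjoint_mat_def msmul_def vec_eq_iff)

lemma adjoint_rank_one: "adjoint_mat (rank_one a b) = rank_one b a"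
  by (simp add: adjoint_mat_def rank_one_def vec_eq_iff mult.commute)

lemma rank_one_mult_vec: "rank_one a b *v x = cinner b x *s a"
  by (simp add: rank_one_def matrix_vector_mult_def cinner_def vec_eq_iff sum_distrib_left mult_ac)

lemma msmul_mult_vec: "msmul c A *v x = c *s (A *v x)"
  by (simp add: msmul_def matrix_vector_mult_def vec_eq_iff sum_distrib_left mult_ac)

lemma msmul_msmul: "msmul c (msmul d A) = msmul (c * d) A"
  by (simp add: msmul_def vec_eq_iff)

lemma msmul_one [simp]: "msmul 1 A = A"
  by (simp add: msmul_def vec_eq_iff)

lemma msmul_add: "msmul c (A + B) = msmul c A + msmul c B"
  by (simp add: msmul_def vec_eq_iff algebra_simps)

lemma matrix_eqI_vec: "(\<And>x. A *v x = B *v x) \<Longrightarrow> A = (B::complex^'n^'n)"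
  by (simp add: matrix_eq)

lemma mult_vec_smult: "A *v (c *s x) = c *s (A *v (x::complex^'n))"
  by (simp add: vector_scalar_commute)

lemma rank_one_eq_0: "rank_one a b = 0 \<longleftrightarrow> a = 0 \<or> b = 0"
  by (auto simp: rank_one_def vec_eq_iff)

section \<open>Proportional vectors\<close>

lemma par_refl: "par x x"
  unfolding par_def by (rule exI[of _ 1]) simp

lemma par_sym: "par x y \<Longrightarrow> par y x"
proof -
  assume "par x y"
  then obtain c where c: "c \<noteq> 0" "y = c *s x" by (auto simp: par_def)
  then have "x = (1/c) *s y" by (simp add: vector_smult_assoc)
  then show ?thesis using c by (auto simp: par_def intro!: exI[of _ "1/c"])
qed

lemma par_commute: "par x y \<longleftrightarrow> par y x"
  using par_sym by blast

lemma par_trans: "par x y \<Longrightarrow> par y z \<Longrightarrow> par x z"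
  unfolding par_def by (metis vector_smult_assoc mult_eq_0_iff)

lemma par_eq_0: "par x y \<Longrightarrow> x = 0 \<longleftrightarrow> y = 0"
  by (auto simp: par_def vec_eq_iff)

lemma par_smult: "c \<noteq> 0 \<Longrightarrow> par x (c *s x)"
  by (auto simp: par_def)

lemma par_mult_vec: "par x y \<Longrightarrow> par (A *v x) (A *v y)"
  by (auto simp: par_def mult_vec_smult)

lemma par_cinner_eq_0:
  assumes "par x x'" "par y y'"
  shows "cinner x y = 0 \<longleftrightarrow> cinner x' y' = 0"
  using assms by (auto simp: par_def cinner_simps)

text \<open>The component of \<open>y\<close> orthogonal to \<open>x\<close> separates them: it
  vanishes only when \<open>y\<close> is a multiple of \<open>x\<close>.\<close>

lemma separating_vector:
  assumes "y \<noteq> 0" "\<not> par x y"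
  shows "\<exists>z. cinner z x = 0 \<and> cinner z y \<noteq> 0"
proof (cases "x = 0")
  case True
  then show ?thesis using assms by (intro exI[of _ y]) (simp add: cinner_simps cinner_self)
next
  case False
  define c where "c = cinner x y / cinner x x"
  define z where "z = y - c *s x"
  have xz: "cinner x z = 0"
    using False by (simp add: z_def c_def cinner_simps cinner_self_eq_0)
  have "z \<noteq> 0"
  proof
    assume "z = 0"
    then have "y = c *s x" by (simp add: z_def)
    then show False using assms by (cases "c = 0") (auto simp: par_def)
  qed
  moreover have "cinner z y = cinner z z"
  proof -
    have "y = z + c *s x" by (simp add: z_def)
    then show ?thesis using xz by (metis add.right_neutral cinner_eq_0_commute cinner_simps(2,6) mult_zero_right)
  qed
  ultimately show ?thesis using xz
    by (intro exI[of _ z]) (auto simp: cinner_self_eq_0 cinner_eq_0_commute[of z x])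
qed

text \<open>A line is recovered from its orthogonal hyperplane. This is how information about
  orthogonality is turned into equality of projective points, with 0 included because it is
  orthogonal to everything.\<close>

lemma par_iff_orth: "par x y \<longleftrightarrow> (\<forall>z. cinner z x = 0 \<longleftrightarrow> cinner z y = 0)"
proof
  assume "par x y"
  then show "\<forall>z. cinner z x = 0 \<longleftrightarrow> cinner z y = 0"
    using par_cinner_eq_0 par_refl by blast
next
  assume *: "\<forall>z. cinner z x = 0 \<longleftrightarrow> cinner z y = 0"
  show "par x y"
  proof (cases "y = 0")
    case True
    then have "x = 0" using * by (metis cinner_self_eq_0 cinner_simps(8))
    then show ?thesis using True par_refl by simp
  next
    case False
    then show ?thesis using * separating_vector by blast
  qed
qed

lemma exists_orth:
  assumes "CARD('n) \<ge> 2"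
  shows "\<exists>y::complex^'n. y \<noteq> 0 \<and> cinner x y = 0"
proof (cases "\<exists>i. x$i = 0")
  case True
  then obtain i where "x$i = 0" by blast
  then show ?thesis by (intro exI[of _ "axis i 1"]) (simp add: axis_eq_0_iff)
next
  case False
  obtain i j :: 'n where ij: "i \<noteq> j"
    using assms by (metis UNIV_I card_2_iff' ex_card)
  \<comment> \<open>Two coordinates are swapped with a sign; the conjugates match those that
    \<open>cinner\<close> puts on \<open>x\<close>, so the two terms cancel.\<close>
  define y where "y = cnj (x$j) *s axis i 1 - cnj (x$i) *s axis j (1::complex)"
  have "y$i = cnj (x$j)" using ij by (simp add: y_def axis_def)
  then have "y \<noteq> 0" using False by (metis complex_cnj_zero_iff zero_index)
  moreover have "cinner x y = 0" by (simp add: y_def cinner_simps mult.commute)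
  ultimately show ?thesis by blast
qed

lemma exists_not_par:
  assumes "CARD('n) \<ge> 2" "x \<noteq> 0"
  shows "\<exists>y::complex^'n. y \<noteq> 0 \<and> \<not> par x y"
proof -
  obtain y :: "complex^'n" where y: "y \<noteq> 0" "cinner x y = 0" using exists_orth[OF assms(1)] by blast
  have "\<not> par x y"
    using y assms(2) by (auto simp: par_def cinner_simps cinner_self_eq_0)
  then show ?thesis using y by blast
qed

section \<open>The operator norm\<close>

definition attains :: "complex^'n^'n \<Rightarrow> complex^'n \<Rightarrow> bool" where
  "attains A x \<longleftrightarrow> norm (A *v x) = opnorm A * norm x"

lemma norm_mult_vec_le: "norm (A *v x) \<le> opnorm A * norm (x::complex^'n)"
  unfolding opnorm_def by (rule onorm) simp

lemma opnorm_nonneg: "0 \<le> opnorm A"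
  unfolding opnorm_def by (rule onorm_pos_le) simp

lemma opnorm_bound:
  assumes "0 \<le> b" "\<And>x. norm (A *v x) \<le> b * norm x"
  shows "opnorm A \<le> b"
  unfolding opnorm_def by (rule onorm_bound[OF assms])

lemma exists_attaining: "\<exists>x::complex^'n. norm x = 1 \<and> norm (A *v x) = opnorm A"
proof -
  have "compact (sphere (0::complex^'n) 1)" by simp
  moreover have "axis undefined 1 \<in> sphere (0::complex^'n) 1" by simp
  then have "sphere (0::complex^'n) 1 \<noteq> {}" by blast
  moreover have "continuous_on (sphere 0 1) (\<lambda>x. norm (A *v x))"
    by (intro continuous_intros linear_continuous_on matrix_vector_mul_bounded_linear)
  ultimately obtain x where x: "x \<in> sphere 0 1"
    and max: "\<And>y. y \<in> sphere 0 1 \<Longrightarrow> norm (A *v y) \<le> norm (A *v x)"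
    using continuous_attains_sup[of "sphere (0::complex^'n) 1" "\<lambda>x. norm (A *v x)"] by blast
  have "norm (A *v y) \<le> norm (A *v x) * norm y" for y
  proof (cases "y = 0")
    case False
    have "norm (A *v ((1 / norm y) *\<^sub>R y)) \<le> norm (A *v x)"
      by (rule max) (use False in simp)
    then show ?thesis using False
      by (simp add: linear_scale[OF bounded_linear.linear[OF matrix_vector_mul_bounded_linear]] field_simps)
  qed simp
  then have "opnorm A \<le> norm (A *v x)" by (intro opnorm_bound) auto
  moreover have "norm (A *v x) \<le> opnorm A" using norm_mult_vec_le[of A x] x by simp
  ultimately show ?thesis using x by auto
qed

lemma opnorm_eq_0: "opnorm A = 0 \<longleftrightarrow> A = 0"
proof
  assume "opnorm A = 0"
  then have "A *v x = 0" for x using norm_mult_vec_le[of A x] by simp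
  then show "A = 0" by (intro matrix_eqI_vec) simp
next
  assume "A = 0"
  then have "opnorm A \<le> 0" by (intro opnorm_bound) auto
  then show "opnorm A = 0" using opnorm_nonneg[of A] by simp
qed

lemma opnorm_msmul: "opnorm (msmul c A) = cmod c * opnorm A"
proof (rule antisym)
  show "opnorm (msmul c A) \<le> cmod c * opnorm A"
    by (rule opnorm_bound)
      (auto simp: opnorm_nonneg msmul_mult_vec norm_vector_smult mult.assoc norm_mult_vec_le mult_left_mono)
  obtain x :: "complex^'a" where x: "norm x = 1" "norm (A *v x) = opnorm A"
    using exists_attaining by blast
  have "norm (msmul c A *v x) \<le> opnorm (msmul c A) * norm x" by (rule norm_mult_vec_le)
  then show "cmod c * opnorm A \<le> opnorm (msmul c A)"
    using x by (simp add: msmul_mult_vec norm_vector_smult)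
qed

lemma opnorm_adjoint_le: "opnorm (adjoint_mat A) \<le> opnorm A"
proof (rule opnorm_bound)
  fix x :: "complex^'a"
  let ?y = "adjoint_mat A *v x"
  have "(norm ?y)\<^sup>2 = Re (cinner ?y ?y)" by (rule norm_sq_eq_cinner)
  also have "\<dots> = Re (cinner x (A *v ?y))" by (simp add: cinner_adjoint)
  also have "\<dots> \<le> norm x * norm (A *v ?y)"
  proof -
    have "inner x (A *v ?y) = Re (cinner x (A *v ?y))"
      by (simp add: inner_vec_def cinner_def inner_complex_def)
    then show ?thesis using norm_cauchy_schwarz[of x "A *v ?y"] by simp
  qed
  also have "\<dots> \<le> norm x * (opnorm A * norm ?y)"
    by (intro mult_left_mono norm_mult_vec_le) simp
  finally have "norm ?y * norm ?y \<le> (opnorm A * norm x) * norm ?y"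
    by (simp add: power2_eq_square mult_ac)
  then show "norm ?y \<le> opnorm A * norm x"
    by (cases "norm ?y = 0") (auto simp: opnorm_nonneg)
qed (rule opnorm_nonneg)

lemma opnorm_adjoint: "opnorm (adjoint_mat A) = opnorm A"
  using opnorm_adjoint_le[of A] opnorm_adjoint_le[of "adjoint_mat A"] by simp

section \<open>Vectors at which the norm is attained\<close>

lemma attains_smult: "attains A x \<Longrightarrow> attains A (c *s x)"
  by (simp add: attains_def mult_vec_smult norm_vector_smult)

text \<open>The parallelogram law turns the bounds at \<open>x + y\<close> and \<open>x - y\<close>
  into an equality of their sums, so neither bound is strict. The attaining vectors thus form a
  subspace, the top eigenspace of \<open>adjoint_mat A ** A\<close>.\<close>

lemma attains_add:
  assumes "attains A x" "attains A y"
  shows "attains A (x + y)"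
proof -
  have par: "(norm (u + v))\<^sup>2 + (norm (u - v))\<^sup>2 = 2 * (norm u)\<^sup>2 + 2 * (norm v)\<^sup>2" for u v :: "complex^'a"
    using norm_add_sq[of u v] norm_add_sq[of u "-v"] by (simp add: cinner_simps)
  have le: "(norm (A *v z))\<^sup>2 \<le> (opnorm A)\<^sup>2 * (norm z)\<^sup>2" for z
    using power_mono[OF norm_mult_vec_le[of A z], of 2] by (simp add: power_mult_distrib)
  have "(norm (A *v (x + y)))\<^sup>2 + (norm (A *v (x - y)))\<^sup>2
      = (opnorm A)\<^sup>2 * (norm (x + y))\<^sup>2 + (opnorm A)\<^sup>2 * (norm (x - y))\<^sup>2"
  proof -
    have "(norm (A *v (x + y)))\<^sup>2 + (norm (A *v (x - y)))\<^sup>2 = 2 * (norm (A *v x))\<^sup>2 + 2 * (norm (A *v y))\<^sup>2"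
      unfolding matrix_vector_right_distrib matrix_vector_mult_diff_distrib by (rule par)
    also have "\<dots> = (opnorm A)\<^sup>2 * (2 * (norm x)\<^sup>2 + 2 * (norm y)\<^sup>2)"
      using assms unfolding attains_def by (simp only: power_mult_distrib) (simp add: distrib_left)
    also have "\<dots> = (opnorm A)\<^sup>2 * ((norm (x + y))\<^sup>2 + (norm (x - y))\<^sup>2)"
      by (simp only: par)
    finally show ?thesis by (simp only: distrib_left)
  qed
  then have "(norm (A *v (x + y)))\<^sup>2 = (opnorm A * norm (x + y))\<^sup>2"
    using le[of "x + y"] le[of "x - y"] by (simp add: power_mult_distrib)
  then show ?thesis
    unfolding attains_def by (simp add: power2_eq_iff_nonneg opnorm_nonneg)
qed

lemma attains_diff: "attains A x \<Longrightarrow> attains A y \<Longrightarrow> attains A (x - y)"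
  using attains_add[of A x "-1 *s y"] attains_smult[of A y "-1"] by simp

text \<open>A maximizing vector is a critical point of \<open>norm (A *v x) / norm x\<close>.\<close>

lemma attains_orth_image:
  assumes "attains A x" "cinner x y = 0"
  shows "cinner (A *v x) (A *v y) = 0"
proof (rule ccontr)
  define p where "p = cinner (A *v x) (A *v y)"
  assume "cinner (A *v x) (A *v y) \<noteq> 0"
  then have p: "p \<noteq> 0" by (simp add: p_def)
  \<comment> \<open>Moving from \<open>x\<close> to \<open>x + t *s y\<close> gains 2 |p|^2 / K to
    first order, while the second-order loss is at most |t|^2 K = |p|^2 / K. The summand 1 makes
    \<open>K\<close> positive without a case distinction.\<close>
  define K where "K = (opnorm A)\<^sup>2 * (norm y)\<^sup>2 + 1"
  have K: "K > 0" unfolding K_def by (smt (verit) zero_le_power2 mult_nonneg_nonneg)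
  define t where "t = of_real (1 / K) * cnj p"
  have ineq: "(norm (A *v (x + t *s y)))\<^sup>2 \<le> (opnorm A)\<^sup>2 * (norm (x + t *s y))\<^sup>2"
    using power_mono[OF norm_mult_vec_le[of A "x + t *s y"], of 2] by (simp add: power_mult_distrib)
  have n: "(norm (x + t *s y))\<^sup>2 = (norm x)\<^sup>2 + (cmod t)\<^sup>2 * (norm y)\<^sup>2"
    using assms(2) by (simp add: norm_add_sq cinner_simps norm_vector_smult power_mult_distrib)
  have tp: "Re (t * p) = (cmod p)\<^sup>2 / K"
  proof -
    have "t * p = of_real ((cmod p)\<^sup>2 / K)"
      unfolding t_def using complex_norm_square[of p] by (simp add: mult_ac)
    then show ?thesis by simp
  qed
  have m: "(norm (A *v (x + t *s y)))\<^sup>2 = (opnorm A)\<^sup>2 * (norm x)\<^sup>2 + (cmod t)\<^sup>2 * (norm (A *v y))\<^sup>2 + 2 * ((cmod p)\<^sup>2 / K)"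
    using assms(1) tp
    by (simp add: matrix_vector_right_distrib mult_vec_smult norm_add_sq norm_vector_smult cinner_simps
        power_mult_distrib attains_def p_def)
  have "2 * ((cmod p)\<^sup>2 / K) \<le> (cmod t)\<^sup>2 * ((opnorm A)\<^sup>2 * (norm y)\<^sup>2)"
    using ineq unfolding n m by (smt (verit) zero_le_power2 mult_nonneg_nonneg distrib_left mult.left_commute)
  also have "\<dots> \<le> (cmod t)\<^sup>2 * K" by (intro mult_left_mono) (auto simp: K_def)
  also have "\<dots> = (cmod p)\<^sup>2 / K"
    using K by (simp add: t_def norm_mult norm_divide power_mult_distrib power2_eq_square field_simps)
  finally have "(cmod p)\<^sup>2 / K \<le> 0" by simp
  then show False using p K by (simp add: divide_le_0_iff)
qed

text \<open>By Pythagoras, adding a multiple of \<open>B x\<close> cannot shorten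
  \<open>A x\<close>, which already has maximal length.\<close>

lemma bj_orthI:
  assumes "attains A x" "x \<noteq> 0" "cinner (A *v x) (B *v x) = 0"
  shows "bj_orth A B"
  unfolding bj_orth_def
proof
  fix t
  have "(norm ((A + msmul t B) *v x))\<^sup>2 = (norm (A *v x))\<^sup>2 + (norm (t *s (B *v x)))\<^sup>2"
    using assms(3) by (simp add: matrix_vector_mult_add_rdistrib msmul_mult_vec norm_add_sq cinner_simps)
  then have "(norm (A *v x))\<^sup>2 \<le> (norm ((A + msmul t B) *v x))\<^sup>2" by simp
  then have "norm (A *v x) \<le> norm ((A + msmul t B) *v x)" using power2_le_imp_le by force
  also have "\<dots> \<le> opnorm (A + msmul t B) * norm x" by (rule norm_mult_vec_le)
  finally show "opnorm A \<le> opnorm (A + msmul t B)"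
    using assms(1,2) by (simp add: attains_def)
qed

text \<open>The witness is a limit of vectors at which \<open>A - t B\<close> attains its norm, for \<open>t\<close> decreasing
  to 0. Replacing \<open>B\<close> by its unimodular multiples recovers the full converse for smooth \<open>A\<close>.\<close>

lemma bj_orthD:
  assumes "bj_orth A B"
  shows "\<exists>x. norm x = 1 \<and> attains A x \<and> Re (cinner (A *v x) (B *v x)) \<le> 0"
proof -
  define t where "t n = 1 / real (Suc n)" for n
  define C where "C n = A + msmul (of_real (- t n)) B" for n
  have "\<forall>n. \<exists>x. norm x = 1 \<and> norm (C n *v x) = opnorm (C n)" using exists_attaining by blast
  then obtain X where X: "\<And>n. norm (X n) = 1" "\<And>n. norm (C n *v X n) = opnorm (C n)" by metis
  have ge: "opnorm A \<le> opnorm (C n)" for n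
    using assms unfolding bj_orth_def C_def by blast
  have C: "C n *v x = A *v x - t n *\<^sub>R (B *v x)" for n x
  proof -
    have "complex_of_real (- t n) *s (B *v x) = - (t n *\<^sub>R (B *v x))"
      unfolding vec_eq_iff by (simp add: scaleR_conv_of_real[where 'a=complex])
    then show ?thesis
      unfolding C_def matrix_vector_mult_add_rdistrib msmul_mult_vec by simp
  qed
  have "compact (sphere (0::complex^'a) 1)" by simp
  then have "seq_compact (sphere (0::complex^'a) 1)" by (simp add: compact_imp_seq_compact)
  then obtain l r where l: "l \<in> sphere 0 1" and r: "strict_mono r" and lim: "(X \<circ> r) \<longlonglongrightarrow> l"
    using X(1) unfolding seq_compact_def by (metis mem_sphere_0)
  define Y where "Y = X \<circ> r"
  have Y: "Y \<longlonglongrightarrow> l" using lim Y_def by simp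
  have AY: "(\<lambda>n. D *v Y n) \<longlonglongrightarrow> D *v l" for D :: "complex^'a^'a"
    by (rule bounded_linear.tendsto[OF matrix_vector_mul_bounded_linear Y])
  have t0: "t \<longlonglongrightarrow> 0" unfolding t_def
    using LIMSEQ_inverse_real_of_nat by (simp add: inverse_eq_divide)
  have tr: "(\<lambda>n. t (r n)) \<longlonglongrightarrow> 0"
    using LIMSEQ_subseq_LIMSEQ[OF t0 r] by (simp add: o_def)
  have "opnorm A \<le> norm (A *v Y n) + t (r n) * norm (B *v Y n)" for n
  proof -
    have "opnorm A \<le> norm (C (r n) *v Y n)" using ge[of "r n"] X(2)[of "r n"] by (simp add: Y_def)
    also have "\<dots> \<le> norm (A *v Y n) + norm (t (r n) *\<^sub>R (B *v Y n))"
      unfolding C by (rule norm_triangle_ineq4)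
    finally show ?thesis by (simp add: t_def)
  qed
  moreover have "(\<lambda>n. norm (A *v Y n) + t (r n) * norm (B *v Y n)) \<longlonglongrightarrow> norm (A *v l) + 0 * norm (B *v l)"
    by (intro tendsto_intros AY tr)
  ultimately have "opnorm A \<le> norm (A *v l) + 0 * norm (B *v l)"
    by (intro LIMSEQ_le_const) auto
  then have att: "attains A l"
    using norm_mult_vec_le[of A l] l by (simp add: attains_def)
  \<comment> \<open>At \<open>Y n\<close> the matrix \<open>A\<close> reaches at most
    \<open>opnorm A\<close> and the perturbed matrix \<open>C (r n)\<close> at least that. Comparing
    squared lengths and dividing by \<open>t (r n)\<close> gives a bound that tends to 0.\<close>
  have "2 * inner (A *v Y n) (B *v Y n) \<le> t (r n) * (norm (B *v Y n))\<^sup>2" for n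
  proof -
    have tp: "t (r n) > 0" by (simp add: t_def)
    have "norm (A *v Y n) \<le> opnorm A"
      using norm_mult_vec_le[of A "Y n"] X(1)[of "r n"] by (simp add: Y_def)
    also have "\<dots> \<le> norm (C (r n) *v Y n)" using ge[of "r n"] X(2)[of "r n"] by (simp add: Y_def)
    finally have "(norm (A *v Y n))\<^sup>2 \<le> (norm (A *v Y n - t (r n) *\<^sub>R (B *v Y n)))\<^sup>2"
      unfolding C by (rule power_mono) simp
    then have "t (r n) * (2 * inner (A *v Y n) (B *v Y n)) \<le> t (r n) * (t (r n) * (norm (B *v Y n))\<^sup>2)"
      by (simp add: power2_norm_eq_inner inner_diff_left inner_diff_right inner_commute algebra_simps)
    then show ?thesis using tp by simp
  qed
  moreover have "(\<lambda>n. t (r n) * (norm (B *v Y n))\<^sup>2 - 2 * inner (A *v Y n) (B *v Y n))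
      \<longlonglongrightarrow> 0 * (norm (B *v l))\<^sup>2 - 2 * inner (A *v l) (B *v l)"
    by (intro tendsto_intros AY tr)
  ultimately have "0 \<le> 0 * (norm (B *v l))\<^sup>2 - 2 * inner (A *v l) (B *v l)"
    by (intro LIMSEQ_le_const) (auto simp: algebra_simps)
  moreover have "inner (A *v l) (B *v l) = Re (cinner (A *v l) (B *v l))"
    by (simp add: inner_vec_def cinner_def inner_complex_def)
  ultimately show ?thesis using att l by (intro exI[of _ l]) auto
qed

section \<open>Orthogonality characterizations of smooth points and of rank one\<close>

text \<open>At a nonzero \<open>A\<close> the operator norm is differentiable exactly when it is
  attained on a single line. Otherwise two attaining vectors can be chosen orthogonal, since
  attaining vectors form a subspace. In dimension at least two the zero matrix counts as
  nonsmooth.\<close>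

definition nonsmooth :: "complex^'n^'n \<Rightarrow> bool" where
  "nonsmooth A \<longleftrightarrow> (\<exists>x y. x \<noteq> 0 \<and> y \<noteq> 0 \<and> cinner x y = 0 \<and> attains A x \<and> attains A y)"

definition is_rank_one :: "complex^'n^'n \<Rightarrow> bool" where
  "is_rank_one R \<longleftrightarrow> (\<exists>a b. a \<noteq> 0 \<and> b \<noteq> 0 \<and> R = rank_one a b)"

lemma smooth_attains_par:
  assumes "\<not> nonsmooth A" "attains A x" "x \<noteq> 0" "attains A y" "y \<noteq> 0"
  shows "par x y"
proof -
  define c where "c = cinner x y / cinner x x"
  define z where "z = y - c *s x"
  have "cinner x z = 0"
    using assms(3) by (simp add: z_def c_def cinner_simps cinner_self_eq_0)
  moreover have "attains A z" unfolding z_def using assms by (intro attains_diff attains_smult)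
  ultimately have "z = 0" using assms unfolding nonsmooth_def by blast
  then have "y = c *s x" by (simp add: z_def)
  then show ?thesis using assms(5) by (cases "c = 0") (auto simp: par_def)
qed

lemma bj_orth_msmul_right:
  assumes "bj_orth A B"
  shows "bj_orth A (msmul c B)"
  using assms by (simp add: bj_orth_def msmul_msmul)

lemma bj_orth_self: "bj_orth A A \<longleftrightarrow> A = 0"
proof
  assume "bj_orth A A"
  then have "opnorm A \<le> opnorm (A + msmul (-1) A)" unfolding bj_orth_def by blast
  moreover have "A + msmul (-1) A = 0" by (simp add: msmul_def vec_eq_iff)
  moreover have "opnorm (0::complex^'a^'a) = 0" by (simp add: opnorm_eq_0)
  ultimately have "opnorm A = 0" using opnorm_nonneg[of A] by simp
  then show "A = 0" by (simp add: opnorm_eq_0)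
next
  assume "A = 0"
  moreover have "opnorm (0::complex^'a^'a) = 0" by (simp add: opnorm_eq_0)
  ultimately show "bj_orth A A" by (simp add: bj_orth_def opnorm_nonneg)
qed

lemma bj_orth_zero_left: "bj_orth 0 B"
proof -
  have "opnorm (0::complex^'a^'a) = 0" by (simp add: opnorm_eq_0)
  then show ?thesis by (simp add: bj_orth_def opnorm_nonneg)
qed

lemma smooth_bj_orth_iff:
  assumes "\<not> nonsmooth A" "attains A x" "x \<noteq> 0"
  shows "bj_orth A B \<longleftrightarrow> cinner (A *v x) (B *v x) = 0"
proof
  assume orth: "bj_orth A B"
  show "cinner (A *v x) (B *v x) = 0"
  proof (rule ccontr)
    define p where "p = cinner (A *v x) (B *v x)"
    assume "cinner (A *v x) (B *v x) \<noteq> 0"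
    then have p: "p \<noteq> 0" by (simp add: p_def)
    \<comment> \<open>The factor \<open>cnj p\<close> makes the inner product positive at every
      nonzero vector of the only attaining line, against the sign supplied by
      \<open>bj_orthD\<close>.\<close>
    have "bj_orth A (msmul (cnj p) B)" using orth by (rule bj_orth_msmul_right)
    then obtain y where y: "norm y = 1" "attains A y" "Re (cinner (A *v y) (msmul (cnj p) B *v y)) \<le> 0"
      using bj_orthD by blast
    have "y \<noteq> 0" using y by auto
    then obtain c where c: "c \<noteq> 0" "y = c *s x"
      using smooth_attains_par[OF assms y(2)] by (auto simp: par_def)
    have "cinner (A *v y) (msmul (cnj p) B *v y) = (c * cnj c) * (p * cnj p)"
      by (simp add: c msmul_mult_vec mult_vec_smult cinner_simps p_def)
    also have "\<dots> = of_real ((cmod c)\<^sup>2 * (cmod p)\<^sup>2)"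
      using complex_norm_square[of c] complex_norm_square[of p] by simp
    finally have "(cmod c)\<^sup>2 * (cmod p)\<^sup>2 \<le> 0" using y(3) by simp
    then show False using c p by (simp add: mult_le_0_iff)
  qed
next
  assume "cinner (A *v x) (B *v x) = 0"
  then show "bj_orth A B" using assms bj_orthI by blast
qed

text \<open>The image of a rank-one matrix is one line, so it contains no two nonzero orthogonal
  vectors. If \<open>x\<close> were not on the line of \<open>b\<close>, a vector orthogonal to
  \<open>x\<close> with nonzero image would violate \<open>attains_orth_image\<close>.\<close>

lemma rank_one_attains_par:
  assumes "a \<noteq> 0" "b \<noteq> 0" "attains (rank_one a b) x" "x \<noteq> 0"
  shows "par x b"
proof (rule ccontr)
  let ?R = "rank_one a b"
  assume "\<not> par x b"
  then obtain z where z: "cinner z x = 0" "cinner z b \<noteq> 0" using separating_vector assms(2) by blast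
  have "opnorm ?R \<noteq> 0" using assms(1,2) by (simp add: opnorm_eq_0 rank_one_eq_0)
  then have "?R *v x \<noteq> 0" using assms(3,4) by (auto simp: attains_def)
  then have bx: "cinner b x \<noteq> 0" by (auto simp: rank_one_mult_vec)
  have "cinner x z = 0" using z(1) cinner_eq_0_commute by blast
  then have "cinner (?R *v x) (?R *v z) = 0" by (rule attains_orth_image[OF assms(3)])
  then have "cnj (cinner b x) * (cinner b z * cinner a a) = 0"
    unfolding rank_one_mult_vec cinner_simps by (simp only: mult_ac)
  then show False using bx z(2) assms(1) by (auto simp: cinner_self_eq_0 cinner_eq_0_commute)
qed

text \<open>Some vector attains the norm, and it must lie on the line of \<open>b\<close>; the value
  of the norm is never computed.\<close>

lemma rank_one_attains:
  assumes "a \<noteq> 0" "b \<noteq> 0"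
  shows "attains (rank_one a b) b"
proof -
  obtain x where x: "norm x = 1" "norm (rank_one a b *v x) = opnorm (rank_one a b)"
    using exists_attaining by blast
  then have "attains (rank_one a b) x" "x \<noteq> 0" by (auto simp: attains_def)
  moreover from this have "par x b" using rank_one_attains_par assms by blast
  ultimately show ?thesis using attains_smult by (auto simp: par_def)
qed

lemma rank_one_smooth:
  assumes "a \<noteq> 0" "b \<noteq> 0"
  shows "\<not> nonsmooth (rank_one a b)"
proof
  assume "nonsmooth (rank_one a b)"
  then obtain x y where xy: "x \<noteq> 0" "y \<noteq> 0" "cinner x y = 0"
    "attains (rank_one a b) x" "attains (rank_one a b) y"
    by (auto simp: nonsmooth_def)
  then have "par x y" using rank_one_attains_par assms par_sym par_trans by meson
  then show False using xy by (auto simp: par_def cinner_simps cinner_self_eq_0)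
qed

lemma rank_one_bj_orth_iff:
  assumes "a \<noteq> 0" "b \<noteq> 0"
  shows "bj_orth (rank_one a b) B \<longleftrightarrow> cinner a (B *v b) = 0"
  using smooth_bj_orth_iff[OF rank_one_smooth rank_one_attains, OF assms assms assms(2)] assms(2)
  by (simp add: rank_one_mult_vec cinner_simps cinner_self_eq_0)

lemma rank_one_bj_orth_rank_one:
  assumes "a \<noteq> 0" "b \<noteq> 0"
  shows "bj_orth (rank_one a b) (rank_one c d) \<longleftrightarrow> cinner a c = 0 \<or> cinner b d = 0"
  using assms by (auto simp: rank_one_bj_orth_iff rank_one_mult_vec cinner_simps cinner_eq_0_commute)

text \<open>Here \<open>\<not> bj_orth C C\<close> encodes that \<open>C\<close> is nonzero. If
  \<open>A\<close> attains its norm at orthogonal \<open>x\<close> and \<open>y\<close>, then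
  \<open>C = rank_one (A *v x) x\<close> works: it tests \<open>B\<close> only at \<open>x\<close>,
  and it kills \<open>y\<close>. If \<open>A\<close> is smooth, the matrices to which it is
  orthogonal form a hyperplane, too small to contain those of such a \<open>C\<close>.\<close>

lemma nonsmooth_iff_bj_orth:
  fixes A :: "complex^'n^'n"
  assumes n: "CARD('n) \<ge> 2"
  shows "nonsmooth A \<longleftrightarrow>
    (\<exists>C. \<not> bj_orth C C \<and> (\<forall>B. bj_orth C B \<longrightarrow> bj_orth A B) \<and> bj_orth A C)"
proof
  assume "nonsmooth A"
  then obtain x y where xy: "x \<noteq> 0" "y \<noteq> 0" "cinner x y = 0" "attains A x" "attains A y"
    by (auto simp: nonsmooth_def)
  show "\<exists>C. \<not> bj_orth C C \<and> (\<forall>B. bj_orth C B \<longrightarrow> bj_orth A B) \<and> bj_orth A C"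
  proof (cases "A = 0")
    case True
    then show ?thesis using xy
      by (intro exI[of _ "rank_one x x"]) (auto simp: bj_orth_zero_left bj_orth_self rank_one_eq_0)
  next
    case False
    have "opnorm A \<noteq> 0" using False by (simp add: opnorm_eq_0)
    then have Ax: "A *v x \<noteq> 0" using xy by (auto simp: attains_def)
    define C where "C = rank_one (A *v x) x"
    have "\<not> bj_orth C C" using Ax xy by (simp add: bj_orth_self C_def rank_one_eq_0)
    moreover have "\<forall>B. bj_orth C B \<longrightarrow> bj_orth A B"
      using xy Ax by (auto simp: C_def rank_one_bj_orth_iff intro: bj_orthI)
    moreover have "bj_orth A C"
      using xy by (intro bj_orthI[of A y]) (auto simp: C_def rank_one_mult_vec cinner_simps)
    ultimately show ?thesis by blast
  qed
next
  assume "\<exists>C. \<not> bj_orth C C \<and> (\<forall>B. bj_orth C B \<longrightarrow> bj_orth A B) \<and> bj_orth A C"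
  then obtain C where C: "C \<noteq> 0" "\<And>B. bj_orth C B \<Longrightarrow> bj_orth A B" "bj_orth A C"
    by (auto simp: bj_orth_self)
  show "nonsmooth A"
  proof (rule ccontr)
    assume sm: "\<not> nonsmooth A"
    obtain x where x: "norm x = 1" "norm (A *v x) = opnorm A" using exists_attaining by blast
    then have attx: "attains A x" and x0: "x \<noteq> 0" by (auto simp: attains_def)
    obtain y where y: "norm y = 1" "norm (C *v y) = opnorm C" using exists_attaining by blast
    then have atty: "attains C y" and y0: "y \<noteq> 0" by (auto simp: attains_def)
    \<comment> \<open>The zero matrix attains its norm everywhere, and in dimension at least two
      that makes it nonsmooth.\<close>
    have Ax: "A *v x \<noteq> 0"
    proof
      assume "A *v x = 0"
      then have "A = 0" using x by (simp add: opnorm_eq_0)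
      obtain v :: "complex^'n" where "v \<noteq> 0" "cinner x v = 0" using exists_orth[OF n] by blast
      then have "nonsmooth A" unfolding nonsmooth_def using x0 \<open>A = 0\<close> opnorm_eq_0[of A]
        by (intro exI[of _ x] exI[of _ v]) (simp add: attains_def)
      then show False using sm by blast
    qed
    have iff: "bj_orth A B \<longleftrightarrow> cinner (A *v x) (B *v x) = 0" for B
      by (rule smooth_bj_orth_iff[OF sm attx x0])
    \<comment> \<open>The matrix \<open>rank_one (A *v x) z\<close> is to refute domination:
      \<open>C\<close> is orthogonal to it, \<open>A\<close> is not. If \<open>y\<close> is on the
      line of \<open>x\<close>, the assumption \<open>bj_orth A C\<close> makes \<open>C y\<close>
      orthogonal to \<open>A x\<close>; otherwise \<open>z\<close> is taken orthogonal to
      \<open>y\<close>.\<close>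
    have "\<exists>z. cinner z x \<noteq> 0 \<and> cinner (C *v y) (rank_one (A *v x) z *v y) = 0"
    proof (cases "par y x")
      case True
      then obtain c where c: "y = c *s x" by (metis par_def par_sym)
      have "cinner (C *v y) (A *v x) = 0"
        using iff[of C] C(3) cinner_eq_0_commute[of "A *v x" "C *v x"]
        by (simp add: c mult_vec_smult cinner_simps)
      then show ?thesis using x0
        by (intro exI[of _ x]) (simp add: cinner_self_eq_0 rank_one_mult_vec cinner_simps)
    next
      case False
      then obtain z where "cinner z y = 0" "cinner z x \<noteq> 0" using separating_vector x0 by blast
      then show ?thesis by (intro exI[of _ z]) (simp add: rank_one_mult_vec cinner_simps)
    qed
    then obtain z where z: "cinner z x \<noteq> 0" "cinner (C *v y) (rank_one (A *v x) z *v y) = 0" by blast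
    have "bj_orth A (rank_one (A *v x) z)" using C(2) bj_orthI[OF atty y0 z(2)] by blast
    then show False using iff z(1) Ax by (simp add: rank_one_mult_vec cinner_simps cinner_self_eq_0)
  qed
qed

text \<open>The attaining vectors contain a plane, which meets the hyperplane orthogonal to
  \<open>b\<close>; there \<open>rank_one a b\<close> vanishes and \<open>bj_orthI\<close>
  applies.\<close>

lemma nonsmooth_bj_orth_rank_one:
  assumes "nonsmooth B"
  shows "bj_orth B (rank_one a b)"
proof -
  obtain x y where xy: "x \<noteq> 0" "y \<noteq> 0" "cinner x y = 0" "attains B x" "attains B y"
    using assms by (auto simp: nonsmooth_def)
  have "\<exists>z. z \<noteq> 0 \<and> attains B z \<and> cinner b z = 0"
  proof (cases "cinner b x = 0")
    case True
    then show ?thesis using xy by blast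
  next
    case False
    define z where "z = y - (cinner b y / cinner b x) *s x"
    have "cinner y z = cinner y y"
      using xy(3) cinner_eq_0_commute[of x y] by (simp add: z_def cinner_simps)
    then have "z \<noteq> 0" using xy(2) by (metis cinner_self_eq_0 cinner_simps(8))
    moreover have "attains B z" unfolding z_def using xy by (intro attains_diff attains_smult)
    moreover have "cinner b z = 0" using False by (simp add: z_def cinner_simps)
    ultimately show ?thesis by blast
  qed
  then obtain z where "z \<noteq> 0" "attains B z" "cinner b z = 0" by blast
  then show ?thesis by (intro bj_orthI[of B z]) (auto simp: rank_one_mult_vec cinner_simps)
qed

lemma cinner_unit: "norm x = 1 \<Longrightarrow> cinner x x = 1"
  by (simp add: cinner_self)

text \<open>If \<open>R\<close> is not of rank one, take \<open>u1 = R v1\<close>, \<open>u2 = R v2\<close> up to normalization for a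
  maximizing \<open>v1\<close> and some \<open>v2\<close> orthogonal to it: the partial isometry \<open>v1 \<mapsto> u1\<close>, \<open>v2 \<mapsto> u2\<close>
  is not smooth and is not orthogonal to \<open>R\<close>.\<close>

lemma exists_nonsmooth_not_bj_orth:
  assumes "R \<noteq> 0" "\<not> is_rank_one R"
  shows "\<exists>B. nonsmooth B \<and> \<not> bj_orth B R"
proof -
  obtain v1 where v1: "norm v1 = 1" "norm (R *v v1) = opnorm R" using exists_attaining by blast
  then have att1: "attains R v1" and v10: "v1 \<noteq> 0" by (auto simp: attains_def)
  have Rv1: "R *v v1 \<noteq> 0" using v1 assms(1) by (metis norm_zero opnorm_eq_0)
  have "\<exists>w. cinner v1 w = 0 \<and> R *v w \<noteq> 0"
  proof (rule ccontr)
    assume "\<not> ?thesis"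
    then have *: "R *v w = 0" if "cinner v1 w = 0" for w using that by blast
    have "R = rank_one (R *v v1) v1"
    proof (rule matrix_eqI_vec)
      fix x
      have "R *v (x - cinner v1 x *s v1) = 0"
        by (rule *) (simp add: cinner_simps cinner_unit v1)
      then show "R *v x = rank_one (R *v v1) v1 *v x"
        by (simp add: matrix_vector_mult_diff_distrib mult_vec_smult rank_one_mult_vec)
    qed
    then show False using assms(2) Rv1 v10 unfolding is_rank_one_def by blast
  qed
  then obtain w where w: "cinner v1 w = 0" "R *v w \<noteq> 0" by blast
  have w0: "w \<noteq> 0" using w by auto
  define v2 where "v2 = of_real (1 / norm w) *s w"
  have v2: "norm v2 = 1" "cinner v1 v2 = 0" "R *v v2 \<noteq> 0"
    using w w0 by (auto simp: v2_def norm_vector_smult cinner_simps mult_vec_smult norm_divide)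
  have v21: "cinner v2 v1 = 0" using v2 cinner_eq_0_commute by blast
  \<comment> \<open>This is where maximality of \<open>v1\<close> enters: it makes
    \<open>u1\<close>, \<open>u2\<close> orthonormal, so that \<open>B\<close> below is a partial
    isometry.\<close>
  have Rorth: "cinner (R *v v1) (R *v v2) = 0" by (rule attains_orth_image[OF att1 v2(2)])
  define r1 r2 where "r1 = norm (R *v v1)" and "r2 = norm (R *v v2)"
  have r: "r1 > 0" "r2 > 0" using Rv1 v2 by (auto simp: r1_def r2_def)
  define u1 u2 where "u1 = of_real (1 / r1) *s (R *v v1)" and "u2 = of_real (1 / r2) *s (R *v v2)"
  have u: "norm u1 = 1" "norm u2 = 1" "cinner u1 u2 = 0"
    using r Rorth by (auto simp: u1_def u2_def norm_vector_smult norm_divide cinner_simps r1_def r2_def)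
  have u21: "cinner u2 u1 = 0" using u cinner_eq_0_commute by blast
  have Ru: "R *v v1 = of_real r1 *s u1" "R *v v2 = of_real r2 *s u2"
    using r by (auto simp: u1_def u2_def)
  define B where "B = rank_one u1 v1 + rank_one u2 v2"
  have B: "B *v x = cinner v1 x *s u1 + cinner v2 x *s u2" for x
    by (simp add: B_def matrix_vector_mult_add_rdistrib rank_one_mult_vec)
  have nB: "(norm (B *v x))\<^sup>2 = (cmod (cinner v1 x))\<^sup>2 + (cmod (cinner v2 x))\<^sup>2" for x
    using u by (simp add: B norm_add_sq cinner_simps norm_vector_smult)
  \<comment> \<open>Keeping the remainder in Bessel's inequality serves twice: it bounds
    \<open>opnorm B\<close> by 1, and it forces every attaining vector of \<open>B\<close> into the
    span of \<open>v1\<close> and \<open>v2\<close>.\<close>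
  have nx: "(norm x)\<^sup>2 = (cmod (cinner v1 x))\<^sup>2 + (cmod (cinner v2 x))\<^sup>2
      + (norm (x - cinner v1 x *s v1 - cinner v2 x *s v2))\<^sup>2" for x
  proof -
    define z where "z = x - cinner v1 x *s v1 - cinner v2 x *s v2"
    have z1: "cinner v1 z = 0" "cinner v2 z = 0"
      using v1 v2 v21 by (auto simp: z_def cinner_simps cinner_unit)
    have "x = (cinner v1 x *s v1 + cinner v2 x *s v2) + z" by (simp add: z_def)
    then have "(norm x)\<^sup>2 = (norm (cinner v1 x *s v1 + cinner v2 x *s v2))\<^sup>2 + (norm z)\<^sup>2"
      using norm_add_sq_orth[of "cinner v1 x *s v1 + cinner v2 x *s v2" z] z1 by (simp add: cinner_simps)
    also have "(norm (cinner v1 x *s v1 + cinner v2 x *s v2))\<^sup>2 = (cmod (cinner v1 x))\<^sup>2 + (cmod (cinner v2 x))\<^sup>2"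
      using v1 v2 by (simp add: norm_add_sq cinner_simps norm_vector_smult)
    finally show ?thesis by (simp add: z_def)
  qed
  have le: "norm (B *v x) \<le> 1 * norm x" for x
  proof -
    have "(norm (B *v x))\<^sup>2 \<le> (norm x)\<^sup>2" unfolding nB nx[of x] by simp
    then show ?thesis using power2_le_imp_le[of "norm (B *v x)" "norm x"] by simp
  qed
  have Bv: "B *v v1 = u1" "B *v v2 = u2"
    using v1 v2 v21 by (auto simp: B cinner_unit)
  have "opnorm B \<le> 1" by (rule opnorm_bound[OF _ le]) simp
  moreover have "1 \<le> opnorm B" using norm_mult_vec_le[of B v1] u v1 Bv by simp
  ultimately have opB: "opnorm B = 1" by simp
  have "attains B v1" "attains B v2" using Bv u v1 v2 opB by (auto simp: attains_def)
  then have "nonsmooth B"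
    unfolding nonsmooth_def using v10 v2 by (intro exI[of _ v1] exI[of _ v2]) auto
  moreover have "\<not> bj_orth B R"
  proof
    assume "bj_orth B R"
    then obtain x where x: "norm x = 1" "attains B x" "Re (cinner (B *v x) (R *v x)) \<le> 0"
      using bj_orthD by blast
    define \<alpha> \<beta> where "\<alpha> = cinner v1 x" and "\<beta> = cinner v2 x"
    have "(norm (B *v x))\<^sup>2 = (norm x)\<^sup>2" using x opB by (simp add: attains_def)
    then have "x - \<alpha> *s v1 - \<beta> *s v2 = 0" using nB[of x] nx[of x] by (simp add: \<alpha>_def \<beta>_def)
    then have "x = \<alpha> *s v1 + \<beta> *s v2" by (simp add: algebra_simps)
    then have "R *v x = (\<alpha> * of_real r1) *s u1 + (\<beta> * of_real r2) *s u2"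
      by (simp add: matrix_vector_right_distrib mult_vec_smult Ru vector_smult_assoc)
    \<comment> \<open>On this span \<open>R\<close> is \<open>B\<close> with its two directions
      stretched by the positive numbers \<open>r1\<close> and \<open>r2\<close>, so the form is
      positive, against the sign from \<open>bj_orthD\<close>.\<close>
    then have "cinner (B *v x) (R *v x) = of_real r1 * (\<alpha> * cnj \<alpha>) + of_real r2 * (\<beta> * cnj \<beta>)"
      using u u21 by (simp add: B cinner_simps cinner_unit \<alpha>_def \<beta>_def)
    then have "cinner (B *v x) (R *v x) = of_real (r1 * (cmod \<alpha>)\<^sup>2 + r2 * (cmod \<beta>)\<^sup>2)"
      using complex_norm_square[of \<alpha>] complex_norm_square[of \<beta>] by simp
    then have le0: "r1 * (cmod \<alpha>)\<^sup>2 + r2 * (cmod \<beta>)\<^sup>2 \<le> 0" using x(3) by simp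
    have "r1 * (cmod \<alpha>)\<^sup>2 \<ge> 0" "r2 * (cmod \<beta>)\<^sup>2 \<ge> 0" using r by auto
    then have "r1 * (cmod \<alpha>)\<^sup>2 = 0" "r2 * (cmod \<beta>)\<^sup>2 = 0" using le0 by linarith+
    then have "\<alpha> = 0" "\<beta> = 0" using r by auto
    then show False using \<open>x = \<alpha> *s v1 + \<beta> *s v2\<close> x(1) by simp
  qed
  ultimately show ?thesis by blast
qed

lemma is_rank_one_iff_bj_orth:
  "is_rank_one R \<longleftrightarrow> \<not> bj_orth R R \<and> (\<forall>B. nonsmooth B \<longrightarrow> bj_orth B R)"
proof
  assume "is_rank_one R"
  then show "\<not> bj_orth R R \<and> (\<forall>B. nonsmooth B \<longrightarrow> bj_orth B R)"
    using nonsmooth_bj_orth_rank_one by (auto simp: is_rank_one_def bj_orth_self rank_one_eq_0)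
next
  assume "\<not> bj_orth R R \<and> (\<forall>B. nonsmooth B \<longrightarrow> bj_orth B R)"
  then show "is_rank_one R"
    using exists_nonsmooth_not_bj_orth[of R] by (metis bj_orth_self)
qed

section \<open>Adjacency of rank-one matrices\<close>

text \<open>Stands in for proportionality of rank-one matrices, see
  \<open>same_orth_rank_one\<close>, in a form that \<open>\<Phi>\<close> visibly preserves.\<close>

definition same_orth :: "complex^'n^'n \<Rightarrow> complex^'n^'n \<Rightarrow> bool" where
  "same_orth R S \<longleftrightarrow> (\<forall>B. bj_orth R B \<longleftrightarrow> bj_orth S B)"

text \<open>Models that the span of \<open>R\<close> and \<open>S\<close> contains a third rank-one
  line. For nonproportional rank-one matrices this happens exactly when they share a factor;
  membership in the span is replaced by a condition on orthogonality to rank-one matrices.\<close>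

definition bj_adjacent :: "complex^'n^'n \<Rightarrow> complex^'n^'n \<Rightarrow> bool" where
  "bj_adjacent R S \<longleftrightarrow> (\<exists>T. is_rank_one T \<and> \<not> same_orth T R \<and> \<not> same_orth T S \<and>
     (\<forall>X. is_rank_one X \<and> bj_orth R X \<and> bj_orth S X \<longrightarrow> bj_orth T X))"

lemma same_orth_rank_one:
  assumes "a \<noteq> 0" "b \<noteq> 0" "c \<noteq> 0" "d \<noteq> 0"
  shows "same_orth (rank_one a b) (rank_one c d) \<longleftrightarrow> par a c \<and> par b d"
proof
  assume *: "same_orth (rank_one a b) (rank_one c d)"
  have "par a c"
  proof (rule ccontr)
    assume "\<not> par a c"
    then obtain z where z: "cinner z a = 0" "cinner z c \<noteq> 0" using separating_vector assms(3) by blast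
    have "bj_orth (rank_one a b) (rank_one z d)"
      using assms z(1) cinner_eq_0_commute[of a z] by (simp add: rank_one_bj_orth_rank_one)
    then have "bj_orth (rank_one c d) (rank_one z d)" using * by (simp add: same_orth_def)
    then show False
      using assms z(2) cinner_eq_0_commute[of c z] by (simp add: rank_one_bj_orth_rank_one cinner_self_eq_0)
  qed
  moreover have "par b d"
  proof (rule ccontr)
    assume "\<not> par b d"
    then obtain z where z: "cinner z b = 0" "cinner z d \<noteq> 0" using separating_vector assms(4) by blast
    have "bj_orth (rank_one a b) (rank_one c z)"
      using assms z(1) cinner_eq_0_commute[of b z] by (simp add: rank_one_bj_orth_rank_one)
    then have "bj_orth (rank_one c d) (rank_one c z)" using * by (simp add: same_orth_def)
    then show False
      using assms z(2) cinner_eq_0_commute[of d z] by (simp add: rank_one_bj_orth_rank_one cinner_self_eq_0)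
  qed
  ultimately show "par a c \<and> par b d" by blast
next
  assume "par a c \<and> par b d"
  then obtain k m where "k \<noteq> 0" "c = k *s a" "m \<noteq> 0" "d = m *s b" by (auto simp: par_def)
  then show "same_orth (rank_one a b) (rank_one c d)"
    using assms by (simp add: same_orth_def rank_one_bj_orth_iff mult_vec_smult cinner_simps)
qed

lemma not_par_add:
  assumes "\<not> par b d" "b \<noteq> 0" "d \<noteq> 0"
  shows "b + d \<noteq> 0" "\<not> par (b + d) b" "\<not> par (b + d) d"
proof -
  have key: "\<not> par (u + v) u" if uv: "\<not> par u v" "v \<noteq> 0" for u v :: "complex^'a"
  proof
    assume "par (u + v) u"
    then obtain k where "u + v = k *s u" by (metis par_def par_sym)
    then have v: "v = (k - 1) *s u" unfolding vector_sub_rdistrib vector_smult_lid by (metis add_diff_cancel_left')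
    then have "k - 1 \<noteq> 0" using uv(2) by (metis vector_smult_lzero)
    then have "par u v" using v unfolding par_def by blast
    then show False using uv(1) by blast
  qed
  show "b + d \<noteq> 0"
  proof
    assume "b + d = 0"
    then have "d = (-1) *s b" using minus_unique[of b d] by simp
    moreover have "(-1::complex) \<noteq> 0" by simp
    ultimately show False using assms(1) unfolding par_def by blast
  qed
  show "\<not> par (b + d) b" using key assms by blast
  show "\<not> par (b + d) d" using key[of d b] assms par_commute by (metis add.commute)
qed

text \<open>With a shared factor, adding the other two factors yields the third matrix. Conversely,
  for \<open>T = rank_one e f\<close> one tests with \<open>x\<close> orthogonal to \<open>a\<close>
  and \<open>y\<close> orthogonal to \<open>d\<close>, and then with the pair \<open>c\<close>,
  \<open>b\<close>.\<close>

lemma bj_adjacent_rank_one: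
  assumes nz: "a \<noteq> 0" "b \<noteq> 0" "c \<noteq> 0" "d \<noteq> 0" and ne: "\<not> (par a c \<and> par b d)"
  shows "bj_adjacent (rank_one a b) (rank_one c d) \<longleftrightarrow> par a c \<or> par b d"
proof
  assume "bj_adjacent (rank_one a b) (rank_one c d)"
  then obtain e f where ef: "e \<noteq> 0" "f \<noteq> 0"
    "\<not> same_orth (rank_one e f) (rank_one a b)" "\<not> same_orth (rank_one e f) (rank_one c d)"
    and X: "\<And>X. is_rank_one X \<Longrightarrow> bj_orth (rank_one a b) X \<Longrightarrow> bj_orth (rank_one c d) X
      \<Longrightarrow> bj_orth (rank_one e f) X"
    unfolding bj_adjacent_def is_rank_one_def by metis
  have np: "\<not> (par e a \<and> par f b)" "\<not> (par e c \<and> par f d)"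
    using ef same_orth_rank_one nz by blast+
  have X': "cinner e x = 0 \<or> cinner f y = 0"
    if "x \<noteq> 0" "y \<noteq> 0" "cinner a x = 0 \<or> cinner b y = 0" "cinner c x = 0 \<or> cinner d y = 0" for x y
    using X[of "rank_one x y"] that nz ef by (auto simp: rank_one_bj_orth_rank_one is_rank_one_def)
  have 1: "par a e \<or> par d f"
  proof (rule ccontr)
    assume "\<not> ?thesis"
    then have "\<not> par a e" "\<not> par d f" by auto
    then obtain x y where "cinner x a = 0" "cinner x e \<noteq> 0" "cinner y d = 0" "cinner y f \<noteq> 0"
      using separating_vector[OF ef(1)] separating_vector[OF ef(2)] by meson
    moreover from this have "x \<noteq> 0" "y \<noteq> 0" by (auto simp: cinner_simps)
    ultimately show False using X'[of x y] cinner_eq_0_commute by blast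
  qed
  have 2: "par c e \<or> par b f"
  proof (rule ccontr)
    assume "\<not> ?thesis"
    then have "\<not> par c e" "\<not> par b f" by auto
    then obtain x y where "cinner x c = 0" "cinner x e \<noteq> 0" "cinner y b = 0" "cinner y f \<noteq> 0"
      using separating_vector[OF ef(1)] separating_vector[OF ef(2)] by meson
    moreover from this have "x \<noteq> 0" "y \<noteq> 0" by (auto simp: cinner_simps)
    ultimately show False using X'[of x y] cinner_eq_0_commute by blast
  qed
  \<comment> \<open>Of the four combinations, two make \<open>T\<close> proportional to one of the
    given matrices; in the other two, \<open>e\<close> links \<open>a\<close> with \<open>c\<close>
    or \<open>f\<close> links \<open>b\<close> with \<open>d\<close>.\<close>
  show "par a c \<or> par b d"
    using 1 2 np par_trans par_sym by blast
next
  assume "par a c \<or> par b d"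
  then show "bj_adjacent (rank_one a b) (rank_one c d)"
  proof
    assume ac: "par a c"
    then have "\<not> par b d" using ne by blast
    note bd = not_par_add[OF this nz(2,4)]
    show ?thesis
      unfolding bj_adjacent_def
    proof (intro exI[of _ "rank_one a (b + d)"] conjI allI impI)
      show "is_rank_one (rank_one a (b + d))" using nz bd by (auto simp: is_rank_one_def)
      show "\<not> same_orth (rank_one a (b + d)) (rank_one a b)"
        "\<not> same_orth (rank_one a (b + d)) (rank_one c d)"
        using nz bd by (auto simp: same_orth_rank_one)
      fix X assume "is_rank_one X \<and> bj_orth (rank_one a b) X \<and> bj_orth (rank_one c d) X"
      then obtain x y where X: "X = rank_one x y" "cinner a x = 0 \<or> cinner b y = 0"
        "cinner c x = 0 \<or> cinner d y = 0"
        using nz unfolding is_rank_one_def by (metis rank_one_bj_orth_rank_one)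
      then have "cinner a x = 0 \<or> cinner (b + d) y = 0"
        using par_cinner_eq_0[OF ac par_refl, of x] by (auto simp: cinner_simps)
      then show "bj_orth (rank_one a (b + d)) X"
        using nz bd X by (simp add: rank_one_bj_orth_rank_one)
    qed
  next
    assume bd: "par b d"
    then have "\<not> par a c" using ne by blast
    note ac = not_par_add[OF this nz(1,3)]
    show ?thesis
      unfolding bj_adjacent_def
    proof (intro exI[of _ "rank_one (a + c) b"] conjI allI impI)
      show "is_rank_one (rank_one (a + c) b)" using nz ac by (auto simp: is_rank_one_def)
      show "\<not> same_orth (rank_one (a + c) b) (rank_one a b)"
        "\<not> same_orth (rank_one (a + c) b) (rank_one c d)"
        using nz ac by (auto simp: same_orth_rank_one)
      fix X assume "is_rank_one X \<and> bj_orth (rank_one a b) X \<and> bj_orth (rank_one c d) X"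
      then obtain x y where X: "X = rank_one x y" "cinner a x = 0 \<or> cinner b y = 0"
        "cinner c x = 0 \<or> cinner d y = 0"
        using nz unfolding is_rank_one_def by (metis rank_one_bj_orth_rank_one)
      then have "cinner (a + c) x = 0 \<or> cinner b y = 0"
        using par_cinner_eq_0[OF bd par_refl, of y] by (auto simp: cinner_simps)
      then show "bj_orth (rank_one (a + c) b) X"
        using nz ac X by (simp add: rank_one_bj_orth_rank_one)
    qed
  qed
qed

section \<open>The action on rank-one matrices\<close>

locale bj_isomorphism =
  fixes \<Phi> :: "complex^'n^'n \<Rightarrow> complex^'n^'n"
  assumes dim: "CARD('n) \<ge> 2"
    and bij: "bij \<Phi>"
    and orth_iff: "bj_orth (\<Phi> A) (\<Phi> B) \<longleftrightarrow> bj_orth A B"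
begin

text \<open>Bijectivity lets quantifiers over matrices run over images, so every predicate built
  from \<open>bj_orth\<close> alone is invariant under \<open>\<Phi>\<close>.\<close>

lemma all_image: "(\<forall>B. P B) \<longleftrightarrow> (\<forall>B. P (\<Phi> B))"
  using bij by (metis bij_pointE)

lemma ex_image: "(\<exists>B. P B) \<longleftrightarrow> (\<exists>B. P (\<Phi> B))"
  using bij by (metis bij_pointE)

lemma nonsmooth_image: "nonsmooth (\<Phi> A) \<longleftrightarrow> nonsmooth A"
  unfolding nonsmooth_iff_bj_orth[OF dim]
  by (subst ex_image, subst all_image) (simp add: orth_iff)

lemma is_rank_one_image: "is_rank_one (\<Phi> A) \<longleftrightarrow> is_rank_one A"
  unfolding is_rank_one_iff_bj_orth
  by (subst all_image) (simp add: orth_iff nonsmooth_image)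

lemma same_orth_image: "same_orth (\<Phi> A) (\<Phi> B) \<longleftrightarrow> same_orth A B"
  unfolding same_orth_def by (subst all_image) (simp add: orth_iff)

lemma bj_adjacent_image: "bj_adjacent (\<Phi> A) (\<Phi> B) \<longleftrightarrow> bj_adjacent A B"
  unfolding bj_adjacent_def
  by (subst ex_image, subst all_image) (simp add: orth_iff is_rank_one_image same_orth_image)

text \<open>A choice is made because the factors of a rank-one matrix are determined only up to
  scalars; all statements about \<open>lft\<close> and \<open>rgt\<close> are therefore in terms of
  \<open>par\<close>.\<close>

definition factors :: "complex^'n \<Rightarrow> complex^'n \<Rightarrow> (complex^'n) \<times> (complex^'n)" where
  "factors x y = (SOME p. fst p \<noteq> 0 \<and> snd p \<noteq> 0 \<and> \<Phi> (rank_one x y) = rank_one (fst p) (snd p))"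

definition lft where "lft x y = fst (factors x y)"
definition rgt where "rgt x y = snd (factors x y)"

lemma image_rank_one:
  assumes "x \<noteq> 0" "y \<noteq> 0"
  shows "lft x y \<noteq> 0" "rgt x y \<noteq> 0" "\<Phi> (rank_one x y) = rank_one (lft x y) (rgt x y)"
proof -
  have "is_rank_one (\<Phi> (rank_one x y))"
    using assms is_rank_one_image by (auto simp: is_rank_one_def)
  then have "\<exists>p. fst p \<noteq> 0 \<and> snd p \<noteq> 0 \<and> \<Phi> (rank_one x y) = rank_one (fst p) (snd p)"
    by (auto simp: is_rank_one_def)
  from someI_ex[OF this]
  show "lft x y \<noteq> 0" "rgt x y \<noteq> 0" "\<Phi> (rank_one x y) = rank_one (lft x y) (rgt x y)"
    by (auto simp: lft_def rgt_def factors_def)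
qed

lemma image_same:
  assumes "x \<noteq> 0" "y \<noteq> 0" "x' \<noteq> 0" "y' \<noteq> 0"
  shows "par (lft x y) (lft x' y') \<and> par (rgt x y) (rgt x' y') \<longleftrightarrow> par x x' \<and> par y y'"
  using same_orth_image[of "rank_one x y" "rank_one x' y'"] assms
  by (simp add: image_rank_one same_orth_rank_one)

lemma image_adjacent:
  assumes "x \<noteq> 0" "y \<noteq> 0" "x' \<noteq> 0" "y' \<noteq> 0"
  shows "par (lft x y) (lft x' y') \<or> par (rgt x y) (rgt x' y') \<longleftrightarrow> par x x' \<or> par y y'"
proof (cases "par x x' \<and> par y y'")
  case True
  then show ?thesis using image_same[OF assms] by blast
next
  case False
  then have "\<not> (par (lft x y) (lft x' y') \<and> par (rgt x y) (rgt x' y'))" using image_same[OF assms] by blast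
  then show ?thesis
    using bj_adjacent_image[of "rank_one x y" "rank_one x' y'"] False assms
    by (simp add: image_rank_one bj_adjacent_rank_one)
qed

section \<open>Rows and columns of rank-one matrices\<close>

lemma factors_surj:
  assumes "p \<noteq> 0" "q \<noteq> 0"
  shows "\<exists>x y. x \<noteq> 0 \<and> y \<noteq> 0 \<and> par p (lft x y) \<and> par q (rgt x y)"
proof -
  obtain A where A: "\<Phi> A = rank_one p q" using bij by (metis bij_pointE)
  then have "is_rank_one A" using is_rank_one_image[of A] assms by (auto simp: is_rank_one_def)
  then obtain x y where xy: "x \<noteq> 0" "y \<noteq> 0" "A = rank_one x y" by (auto simp: is_rank_one_def)
  then have "rank_one p q = rank_one (lft x y) (rgt x y)" using A image_rank_one by simp
  then have "same_orth (rank_one p q) (rank_one (lft x y) (rgt x y))" by (simp add: same_orth_def)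
  then have "par p (lft x y) \<and> par q (rgt x y)"
    using same_orth_rank_one[OF assms image_rank_one(1,2)[OF xy(1,2)]] by simp
  then show ?thesis using xy by blast
qed

text \<open>Picture a rank-one matrix as a grid point (left line, right line). Two points with
  different left lines share a right one, two with different right lines share a left one; a point
  of the first pair must be adjacent to both of the second, which forces its left line to be theirs.
  So the first pair agrees after all.\<close>

lemma row_to_row_or_column:
  assumes "x \<noteq> 0"
  shows "(\<forall>y y'. y \<noteq> 0 \<and> y' \<noteq> 0 \<longrightarrow> par (lft x y) (lft x y')) \<or>
         (\<forall>y y'. y \<noteq> 0 \<and> y' \<noteq> 0 \<longrightarrow> par (rgt x y) (rgt x y'))"
proof (rule ccontr)
  assume "\<not> ?thesis"
  then obtain y1 y2 z1 z2 where y: "y1 \<noteq> 0" "y2 \<noteq> 0" "\<not> par (lft x y1) (lft x y2)"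
    and z: "z1 \<noteq> 0" "z2 \<noteq> 0" "\<not> par (rgt x z1) (rgt x z2)" by blast
  have adj: "par (lft x u) (lft x v) \<or> par (rgt x u) (rgt x v)" if "u \<noteq> 0" "v \<noteq> 0" for u v
    using image_adjacent[OF assms that(1) assms that(2)] par_refl by blast
  show False
    using adj[OF y(1,2)] adj[OF z(1,2)] adj[OF y(1) z(1)] adj[OF y(1) z(2)] adj[OF y(2) z(1)]
      adj[OF y(2) z(2)] y(3) z(3) par_trans par_sym by meson
qed

text \<open>If one row went to a column and another to a row, the crossing of the two images would
  itself be an image, of \<open>rank_one p q\<close> say. Adjacency puts \<open>p\<close> on the
  line of both row factors, so the two rows coincide.\<close>

lemma rows_uniform:
  "(\<forall>x y y'. x \<noteq> 0 \<and> y \<noteq> 0 \<and> y' \<noteq> 0 \<longrightarrow> par (lft x y) (lft x y')) \<or>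
   (\<forall>x y y'. x \<noteq> 0 \<and> y \<noteq> 0 \<and> y' \<noteq> 0 \<longrightarrow> par (rgt x y) (rgt x y'))"
proof (rule ccontr)
  assume "\<not> ?thesis"
  then obtain x y1 y2 x' z1 z2 where y: "x \<noteq> 0" "y1 \<noteq> 0" "y2 \<noteq> 0" "\<not> par (lft x y1) (lft x y2)"
    and z: "x' \<noteq> 0" "z1 \<noteq> 0" "z2 \<noteq> 0" "\<not> par (rgt x' z1) (rgt x' z2)" by blast
  have r: "par (rgt x u) (rgt x v)" if "u \<noteq> 0" "v \<noteq> 0" for u v
    using row_to_row_or_column[OF y(1)] y that by blast
  have l: "par (lft x' u) (lft x' v)" if "u \<noteq> 0" "v \<noteq> 0" for u v
    using row_to_row_or_column[OF z(1)] z that by blast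
  have "lft x' z1 \<noteq> 0" "rgt x y1 \<noteq> 0" using image_rank_one y z by auto
  then obtain p q where pq: "p \<noteq> 0" "q \<noteq> 0" "par (lft x' z1) (lft p q)" "par (rgt x y1) (rgt p q)"
    using factors_surj by blast
  obtain w where w: "w \<noteq> 0" "\<not> par q w" using exists_not_par[OF dim pq(2)] by blast
  have "par p x'"
    using image_adjacent[OF pq(1,2) z(1) w(1)] pq(3) l[OF z(2) w(1)] w(2) par_trans par_sym by blast
  moreover have "par p x"
    using image_adjacent[OF pq(1,2) y(1) w(1)] pq(4) r[OF y(2) w(1)] w(2) par_trans par_sym by blast
  ultimately have "par x x'" using par_trans par_sym by blast
  then have eq: "par (lft x u) (lft x' u)" if "u \<noteq> 0" for u
    using image_same[OF y(1) that z(1) that] par_refl by blast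
  have "par (lft x y1) (lft x y2)"
    using eq[OF y(2)] l[OF y(2,3)] eq[OF y(3)] par_trans par_sym by blast
  then show False using y(4) by blast
qed

text \<open>If rows go to rows then columns go to columns, since otherwise rank-one matrices with
  different rows and columns would become adjacent.\<close>

lemma separated_factors:
  assumes rows: "\<And>x y y'. x \<noteq> 0 \<Longrightarrow> y \<noteq> 0 \<Longrightarrow> y' \<noteq> 0 \<Longrightarrow> par (lft x y) (lft x y')"
  shows "\<exists>f g. (\<forall>x. x \<noteq> 0 \<longrightarrow> f x \<noteq> 0) \<and> (\<forall>y. y \<noteq> 0 \<longrightarrow> g y \<noteq> 0) \<and>
    (\<forall>x y. x \<noteq> 0 \<longrightarrow> y \<noteq> 0 \<longrightarrow> par (lft x y) (f x) \<and> par (rgt x y) (g y))"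
proof -
  have cols: "par (rgt x y) (rgt x' y)" if nz: "x \<noteq> 0" "x' \<noteq> 0" "y \<noteq> 0" for x x' y
  proof (cases "par x x'")
    case True
    then show ?thesis using image_same[OF nz(1,3) nz(2,3)] par_refl by blast
  next
    case False
    show ?thesis
    proof (rule ccontr)
      assume "\<not> ?thesis"
      then have l: "par (lft x y) (lft x' y)"
        using image_adjacent[OF nz(1,3) nz(2,3)] par_refl by blast
      obtain y' where y': "y' \<noteq> 0" "\<not> par y y'" using exists_not_par[OF dim nz(3)] by blast
      have "par (lft x y) (lft x' y')" using l rows[OF nz(2,3) y'(1)] par_trans by blast
      then show False using image_adjacent[OF nz(1,3) nz(2) y'(1)] False y' by blast
    qed
  qed
  define e where "e = (axis undefined 1 :: complex^'n)"
  have e: "e \<noteq> 0" by (simp add: e_def axis_eq_0_iff)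
  show ?thesis
    by (rule exI[of _ "\<lambda>x. lft x e"], rule exI[of _ "\<lambda>y. rgt e y"])
      (simp add: e rows cols image_rank_one)
qed

end

section \<open>Coordinatization of a projective map\<close>

definition hvec :: "(complex \<Rightarrow> complex) \<Rightarrow> complex^'n \<Rightarrow> complex^'n" where
  "hvec h x = (\<chi> i. h (x$i))"

text \<open>\<open>F\<close> matters only up to scalars: it represents a map of the projective space that fixes the
  points of a frame. The value \<open>F 0\<close> is junk.\<close>

locale framed_projective_map =
  fixes F :: "complex^'n \<Rightarrow> complex^'n"
    and \<Psi> :: "complex^'n^'n \<Rightarrow> complex^'n^'n"
    and a :: 'n
  assumes intertwines_0: "y \<noteq> 0 \<Longrightarrow> B *v y = 0 \<Longrightarrow> \<Psi> B *v F y = 0"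
    and intertwines: "y \<noteq> 0 \<Longrightarrow> B *v y \<noteq> 0 \<Longrightarrow> par (F (B *v y)) (\<Psi> B *v F y)"
    and F_smult: "x \<noteq> 0 \<Longrightarrow> k \<noteq> 0 \<Longrightarrow> par (F x) (F (k *s x))"
    and F_inj: "x \<noteq> 0 \<Longrightarrow> y \<noteq> 0 \<Longrightarrow> par (F x) (F y) \<Longrightarrow> par x y"
    and F_axis: "par (F (axis i 1)) (axis i 1)"
    and F_frame: "i \<noteq> a \<Longrightarrow> par (F (axis a 1 + axis i 1)) (axis a 1 + axis i 1)"
    and exists_other: "\<exists>i. i \<noteq> a"
begin

abbreviation e :: "'n \<Rightarrow> complex^'n" where "e i \<equiv> axis i 1"

lemma e_nz [simp]: "e i \<noteq> 0" by (simp add: axis_eq_0_iff)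

lemma e_nth: "e i $ j = (if j = i then 1 else 0)" by (simp add: axis_def)

lemma par_expand: "par x y \<Longrightarrow> \<exists>c. c \<noteq> 0 \<and> y = c *s x" by (simp add: par_def)

section \<open>Vanishing of coordinates\<close>

lemma \<Psi>_axis_0:
  assumes "B *v e j = 0"
  shows "\<Psi> B *v e j = 0"
proof -
  obtain c where "e j = c *s F (e j)" using par_expand[OF F_axis] by blast
  then show ?thesis using intertwines_0[OF e_nz assms] by (metis mult_vec_smult vector_smult_rzero)
qed

lemma \<Psi>_axis:
  assumes "B *v e j \<noteq> 0"
  shows "par (F (B *v e j)) (\<Psi> B *v e j)"
  using intertwines[OF e_nz assms] par_mult_vec[OF F_axis] par_trans by blast

lemma \<Psi>_axis_smult:
  assumes "B *v e j = c *s e i" "c \<noteq> 0"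
  shows "\<exists>d. d \<noteq> 0 \<and> \<Psi> B *v e j = d *s e i"
proof -
  have nz: "B *v e j \<noteq> 0" using assms by (simp add: axis_eq_0_iff)
  have "par (e i) (F (c *s e i))"
    using F_axis[of i] F_smult[OF e_nz assms(2), of i] par_sym par_trans by blast
  then show ?thesis
    using \<Psi>_axis[OF nz] unfolding assms(1) using par_trans par_expand by blast
qed

text \<open>The test matrices used below have at most two nonzero columns, and by
  \<open>\<Psi>_axis_0\<close> their images inherit this. So \<open>\<Psi> B\<close> reads only two
  coordinates of \<open>F x\<close>.\<close>

lemma \<Psi>_two_axes:
  assumes "i \<noteq> j" "\<And>k. k \<noteq> i \<Longrightarrow> k \<noteq> j \<Longrightarrow> B *v e k = 0"
  shows "\<Psi> B *v v = v$i *s (\<Psi> B *v e i) + v$j *s (\<Psi> B *v e j)"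
proof -
  have v: "v = (\<Sum>k\<in>UNIV. v$k *s e k)" by (simp add: basis_expansion)
  have "\<Psi> B *v v = (\<Sum>k\<in>UNIV. v$k *s (\<Psi> B *v e k))"
  proof -
    have "\<Psi> B *v v = \<Psi> B *v (\<Sum>k\<in>UNIV. v$k *s e k)" using v by simp
    also have "\<dots> = (\<Sum>k\<in>UNIV. \<Psi> B *v (v$k *s e k))"
      by (rule linear_sum) (rule bounded_linear.linear, rule matrix_vector_mul_bounded_linear)
    finally show ?thesis by (simp add: mult_vec_smult)
  qed
  also have "\<dots> = (\<Sum>k\<in>{i, j}. v$k *s (\<Psi> B *v e k))"
    by (rule sum.mono_neutral_right) (auto simp: \<Psi>_axis_0 assms(2))
  finally show ?thesis using assms(1) by simp
qed

lemma F_nz: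
  assumes "x \<noteq> 0"
  shows "F x \<noteq> 0"
proof
  assume F0: "F x = 0"
  obtain k where k: "x$k \<noteq> 0" using assms by (metis vec_eq_iff zero_index)
  have B: "rank_one (e a) (e k) *v x = x$k *s e a" by (simp add: rank_one_mult_vec)
  then have "par (F (x$k *s e a)) (\<Psi> (rank_one (e a) (e k)) *v F x)"
    using intertwines[OF assms, of "rank_one (e a) (e k)"] k by simp
  then have "F (x$k *s e a) = 0" using F0 par_eq_0 by fastforce
  then have "e a = 0" using F_smult[OF e_nz k, of a] F_axis[of a] par_eq_0 by blast
  then show False by simp
qed

text \<open>The matrix \<open>rank_one (e a) (e k)\<close> annihilates exactly the vectors whose
  coordinate \<open>k\<close> vanishes, and its image under \<open>\<Psi>\<close> reads that
  coordinate alone. \<open>F_nth_0\<close> is the other half.\<close>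

lemma F_nth_nz:
  assumes "x$k \<noteq> 0"
  shows "F x $ k \<noteq> 0"
proof
  assume F0: "F x $ k = 0"
  \<comment> \<open>A filler for the second index of \<open>\<Psi>_two_axes\<close>: the matrix
    \<open>?B\<close> has the single nonzero column \<open>k\<close>.\<close>
  obtain i where i: "i \<noteq> k" by (metis exists_other)
  let ?B = "rank_one (e a) (e k)"
  have x: "x \<noteq> 0" using assms by auto
  have B: "?B *v x = x$k *s e a" by (simp add: rank_one_mult_vec)
  have "?B *v e j = 0" if "j \<noteq> k" for j using that by (simp add: rank_one_mult_vec e_nth)
  then have "\<Psi> ?B *v F x = F x $ k *s (\<Psi> ?B *v e k) + F x $ i *s (\<Psi> ?B *v e i)"
    by (intro \<Psi>_two_axes) (use i in auto)
  also have "\<dots> = 0"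
    using F0 \<open>\<And>j. j \<noteq> k \<Longrightarrow> ?B *v e j = 0\<close>[OF i] by (simp add: \<Psi>_axis_0)
  finally have "\<Psi> ?B *v F x = 0" .
  moreover have "par (F (?B *v x)) (\<Psi> ?B *v F x)"
    by (rule intertwines[OF x]) (use B assms in simp)
  ultimately have "F (?B *v x) = 0" using par_eq_0 by fastforce
  moreover have "?B *v x \<noteq> 0" using B assms by simp
  ultimately show False using F_nz by blast
qed

lemma F_nth_0:
  assumes "x$k = 0" "x \<noteq> 0"
  shows "F x $ k = 0"
proof -
  obtain i where i: "i \<noteq> k" by (metis exists_other)
  let ?B = "rank_one (e a) (e k)"
  have B: "?B *v x = 0" using assms by (simp add: rank_one_mult_vec)
  have B0: "?B *v e j = 0" if "j \<noteq> k" for j using that by (simp add: rank_one_mult_vec e_nth)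
  have "\<Psi> ?B *v F x = F x $ k *s (\<Psi> ?B *v e k) + F x $ i *s (\<Psi> ?B *v e i)"
    by (intro \<Psi>_two_axes) (use i B0 in auto)
  then have 0: "F x $ k *s (\<Psi> ?B *v e k) = 0"
    using B0[OF i] intertwines_0[OF assms(2) B] by (simp add: \<Psi>_axis_0)
  have "?B *v e k = 1 *s e a" by (simp add: rank_one_mult_vec e_nth)
  then obtain d where "d \<noteq> 0" "\<Psi> ?B *v e k = d *s e a" using \<Psi>_axis_smult[of ?B k 1 a] by auto
  then show ?thesis using 0 by (simp add: vector_smult_assoc)
qed

text \<open>The action of \<open>F\<close> in the affine coordinate of the line through
  \<open>e a\<close> and \<open>e i\<close>; the frame points make it fix 0 and 1. The denominator
  is nonzero by \<open>F_nth_nz\<close>.\<close>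

definition hh :: "'n \<Rightarrow> complex \<Rightarrow> complex" where
  "hh i c = F (e a + c *s e i) $ i / F (e a + c *s e i) $ a"

lemma line_nth:
  assumes "i \<noteq> a"
  shows "(p *s e a + q *s e i) $ a = p"
  using assms by (simp add: e_nth)

lemma F_line:
  assumes "i \<noteq> a" "d \<noteq> 0"
  shows "par (F (d *s e a + c *s e i)) (e a + hh i (c / d) *s e i)"
proof -
  define x where "x = e a + (c / d) *s e i"
  have dx: "d *s x = d *s e a + c *s e i"
    using assms(2) by (simp add: x_def vector_add_ldistrib vector_smult_assoc)
  have xa: "x$a = 1" using assms(1) by (simp add: x_def e_nth)
  have x0: "x \<noteq> 0" using xa by auto
  have Fa: "F x $ a \<noteq> 0" using F_nth_nz xa by simp
  have "e a + hh i (c / d) *s e i = (1 / F x $ a) *s F x"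
    unfolding vec_eq_iff
  proof
    fix j
    consider "j = a" | "j = i" | "j \<noteq> a" "j \<noteq> i" by blast
    then show "(e a + hh i (c / d) *s e i) $ j = ((1 / F x $ a) *s F x) $ j"
    proof cases
      case 3
      then have "x$j = 0" by (simp add: x_def e_nth)
      then have "F x $ j = 0" using F_nth_0 x0 by blast
      then show ?thesis using 3 by (simp add: e_nth)
    qed (use Fa assms(1) in \<open>auto simp: e_nth hh_def x_def\<close>)
  qed
  then have "par (F x) (e a + hh i (c / d) *s e i)" using Fa par_smult[of "1 / F x $ a"] by simp
  moreover have "par (F (d *s x)) (F x)" using F_smult[OF x0 assms(2)] par_sym by blast
  ultimately show ?thesis using par_trans dx by metis
qed

lemma F_line1: "i \<noteq> a \<Longrightarrow> par (F (1 *s e a + c *s e i)) (e a + hh i c *s e i)"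
  using F_line[of i 1 c] by simp

lemma hh_eqI:
  assumes "i \<noteq> a" "d \<noteq> 0" "par (F (d *s e a + c *s e i)) (p *s e a + q *s e i)"
  shows "p \<noteq> 0" "q = hh i (c / d) * p"
proof -
  have "par (e a + hh i (c / d) *s e i) (p *s e a + q *s e i)"
    using F_line[OF assms(1,2)] assms(3) par_sym par_trans by blast
  then obtain k where k: "k \<noteq> 0" "p *s e a + q *s e i = k *s (e a + hh i (c / d) *s e i)"
    using par_expand by blast
  have "p = k" using arg_cong[OF k(2), of "\<lambda>v. v$a"] assms(1) by (simp add: e_nth)
  moreover have "q = k * hh i (c / d)" using arg_cong[OF k(2), of "\<lambda>v. v$i"] assms(1) by (simp add: e_nth)
  ultimately show "p \<noteq> 0" "q = hh i (c / d) * p" using k by auto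
qed

lemma hh_0: "i \<noteq> a \<Longrightarrow> hh i 0 = 0"
  using hh_eqI(2)[of i 1 0 1 0] F_axis[of a] by simp

lemma hh_1: "i \<noteq> a \<Longrightarrow> hh i 1 = 1"
  using hh_eqI(2)[of i 1 1 1 1] F_frame[of i] by simp

text \<open>One matrix \<open>B\<close> sends \<open>e a + d *s e i\<close> to
  \<open>e a + (c + d) *s e j\<close> for all \<open>d\<close> at once, so the ratio \<kappa> of the
  unknown scalars in the two columns of \<open>\<Psi> B\<close> is independent of \<open>d\<close>.
  The case c = 0 yields \<open>hh_indep\<close>, the case i = j yields \<open>h_add\<close>.\<close>

lemma hh_add_aux:
  assumes "i \<noteq> a" "j \<noteq> a"
  shows "\<exists>\<kappa>. \<forall>d. hh j (c + d) = hh j c + \<kappa> * hh i d"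
proof -
  define B where "B = rank_one (e a + c *s e j) (e a) + rank_one (e j) (e i)"
  have B: "B *v x = x$a *s (e a + c *s e j) + x$i *s e j" for x
    by (simp add: B_def matrix_vector_mult_add_rdistrib rank_one_mult_vec)
  have Ba: "B *v e a = 1 *s e a + c *s e j" and Bi: "B *v e i = 1 *s e j"
    using assms by (simp_all add: B e_nth)
  have Ba0: "B *v e a \<noteq> 0"
    unfolding Ba by (metis assms(2) line_nth zero_index zero_neq_one)
  have "par (e a + hh j c *s e j) (\<Psi> B *v e a)"
    using \<Psi>_axis[OF Ba0] par_trans[OF par_sym[OF F_line1[OF assms(2), of c]]] unfolding Ba by simp
  then obtain l where l: "l \<noteq> 0" "\<Psi> B *v e a = l *s (e a + hh j c *s e j)" using par_expand by blast
  obtain m where m: "m \<noteq> 0" "\<Psi> B *v e i = m *s e j" using \<Psi>_axis_smult[OF Bi] by auto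
  have "hh j (c + d) = hh j c + (m / l) * hh i d" for d
  proof -
    define x where "x = 1 *s e a + d *s e i"
    have xa: "x$a = 1" and xi: "x$i = d" using assms(1) by (simp_all add: x_def e_nth)
    have x0: "x \<noteq> 0" using xa by auto
    have Bx: "B *v x = 1 *s e a + (c + d) *s e j"
      by (simp add: B xa xi vector_sadd_rdistrib[of c d] add.assoc vector_sadd_rdistrib)
    have Bx0: "B *v x \<noteq> 0" unfolding Bx by (metis assms(2) line_nth zero_index zero_neq_one)
    have "par (F (B *v x)) (\<Psi> B *v F x)" by (rule intertwines[OF x0 Bx0])
    moreover have "par (\<Psi> B *v F x) (\<Psi> B *v (e a + hh i d *s e i))"
      unfolding x_def by (rule par_mult_vec[OF F_line1[OF assms(1)]])
    ultimately have "par (F (B *v x)) (\<Psi> B *v (e a + hh i d *s e i))" using par_trans by blast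
    moreover have "\<Psi> B *v (e a + hh i d *s e i) = l *s e a + (l * hh j c + m * hh i d) *s e j"
      by (simp add: matrix_vector_right_distrib mult_vec_smult l m vector_add_ldistrib
          vector_sadd_rdistrib vector_smult_assoc add.assoc mult.commute[of m])
    ultimately have "par (F (1 *s e a + (c + d) *s e j)) (l *s e a + (l * hh j c + m * hh i d) *s e j)"
      unfolding Bx by simp
    from hh_eqI(2)[OF assms(2) _ this] have "l * hh j c + m * hh i d = hh j (c + d) * l" by simp
    then show ?thesis using l(1) by (simp add: field_simps)
  qed
  then show ?thesis by blast
qed

lemma hh_indep:
  assumes "i \<noteq> a" "j \<noteq> a"
  shows "hh j = hh i"
proof
  fix d
  obtain k where k: "\<And>d. hh j (0 + d) = hh j 0 + k * hh i d" using hh_add_aux[OF assms] by blast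
  have "k = 1" using k[of 1] assms by (simp add: hh_1 hh_0)
  then show "hh j d = hh i d" using k[of d] assms by (simp add: hh_0)
qed

definition h :: "complex \<Rightarrow> complex" where "h = hh (SOME i. i \<noteq> a)"

lemma hh_h: "i \<noteq> a \<Longrightarrow> hh i = h"
  unfolding h_def using hh_indep[of i "SOME i. i \<noteq> a"] someI_ex[OF exists_other] by simp

lemma h_0: "h 0 = 0" and h_1: "h 1 = 1"
  using exists_other hh_h hh_0 hh_1 by metis+

text \<open>As for addition, with the matrix that scales \<open>e i\<close> by \<open>t\<close>;
  evaluating at 1 identifies the unknown ratio as \<open>h t\<close>.\<close>

lemma h_mult: "h (t * c) = h t * h c"
proof (cases "t = 0")
  case False
  obtain i where i: "i \<noteq> a" using exists_other by blast
  define B where "B = rank_one (e a) (e a) + rank_one (t *s e i) (e i)"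
  have B: "B *v x = x$a *s e a + (x$i * t) *s e i" for x
    by (simp add: B_def matrix_vector_mult_add_rdistrib rank_one_mult_vec vector_smult_assoc)
  have Ba: "B *v e a = 1 *s e a" and Bi: "B *v e i = t *s e i" using i by (simp_all add: B e_nth)
  obtain l where l: "l \<noteq> 0" "\<Psi> B *v e a = l *s e a" using \<Psi>_axis_smult[OF Ba] by auto
  obtain m where m: "m \<noteq> 0" "\<Psi> B *v e i = m *s e i" using \<Psi>_axis_smult[OF Bi False] by auto
  have key: "h (t * d) = (m / l) * h d" for d
  proof -
    define x where "x = 1 *s e a + d *s e i"
    have xa: "x$a = 1" and xi: "x$i = d" using i by (simp_all add: x_def e_nth)
    have x0: "x \<noteq> 0" using xa by auto
    have Bx: "B *v x = 1 *s e a + (t * d) *s e i" by (simp add: B xa xi mult.commute)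
    have Bx0: "B *v x \<noteq> 0" unfolding Bx by (metis i line_nth zero_index zero_neq_one)
    have "par (F (B *v x)) (\<Psi> B *v F x)" by (rule intertwines[OF x0 Bx0])
    moreover have "par (\<Psi> B *v F x) (\<Psi> B *v (e a + hh i d *s e i))"
      unfolding x_def by (rule par_mult_vec[OF F_line1[OF i]])
    ultimately have "par (F (B *v x)) (\<Psi> B *v (e a + hh i d *s e i))" using par_trans by blast
    moreover have "\<Psi> B *v (e a + hh i d *s e i) = l *s e a + (m * hh i d) *s e i"
      by (simp add: matrix_vector_right_distrib mult_vec_smult l m vector_smult_assoc mult.commute[of m])
    ultimately have "par (F (1 *s e a + (t * d) *s e i)) (l *s e a + (m * hh i d) *s e i)"
      unfolding Bx by simp
    from hh_eqI(2)[OF i _ this] have "m * hh i d = hh i (t * d) * l" by simp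
    then show ?thesis using l(1) hh_h[OF i] by (simp add: field_simps)
  qed
  show ?thesis using key[of 1] key[of c] by (simp add: h_1)
qed (simp add: h_0)

lemma h_inj:
  assumes "h c = h d"
  shows "c = d"
proof -
  obtain i where i: "i \<noteq> a" using exists_other by blast
  let ?x = "\<lambda>c. 1 *s e a + c *s e i"
  have nz: "?x c \<noteq> 0" for c by (metis i line_nth zero_index zero_neq_one)
  have "hh i c = hh i d" using assms hh_h[OF i] by simp
  then have "par (F (?x c)) (F (?x d))"
    using par_trans[OF F_line1[OF i, of c]] par_sym[OF F_line1[OF i, of d]] by simp
  then have "par (?x c) (?x d)" using F_inj nz by blast
  then obtain k where k: "?x d = k *s ?x c" using par_expand by blast
  have "k = 1" using arg_cong[OF k, of "\<lambda>v. v$a"] i by (simp add: e_nth)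
  then show ?thesis using arg_cong[OF k, of "\<lambda>v. v$i"] i by (simp add: e_nth)
qed

lemma h_eq_0: "h c = 0 \<longleftrightarrow> c = 0"
  using h_inj[of c 0] h_0 by auto

text \<open>Multiplicativity and injectivity leave -1 as the only value at -1. Additivity cannot be
  invoked, as its proof rests on this.\<close>

lemma h_minus: "h (- c) = - h c"
proof -
  have "h (-1) * h (-1) = 1" using h_mult[of "-1" "-1"] by (simp add: h_1)
  then have "h (-1) = 1 \<or> h (-1) = -1" by (simp add: square_eq_1_iff)
  moreover have "h (-1) \<noteq> 1" using h_inj[of "-1" 1] h_1 by auto
  ultimately show ?thesis using h_mult[of "-1" c] by simp
qed

lemma h_add: "h (c + d) = h c + h d"
proof (cases "c = 0")
  case False
  obtain i where i: "i \<noteq> a" using exists_other by blast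
  obtain k where k: "\<And>d. h (c + d) = h c + k * h d"
    using hh_add_aux[OF i i, of c] unfolding hh_h[OF i] by blast
  \<comment> \<open>At d = -c the left side is \<open>h 0\<close>, which determines
    \<open>k\<close>.\<close>
  have "k = 1" using k[of "-c"] False h_eq_0[of c] by (simp add: h_0 h_minus)
  then show ?thesis using k by simp
qed (simp add: h_0)

section \<open>From coordinate lines to all points\<close>

lemma h_divide_mult: "c \<noteq> 0 \<Longrightarrow> h (d / c) * h c = h d"
  using h_mult[of "d / c" c] by simp

text \<open>The map \<open>x \<mapsto> (x$k, x$i)\<close> to the span of \<open>e a\<close> and \<open>e i\<close> recovers the ratio of the
  coordinates \<open>k\<close> and \<open>i\<close> of \<open>F x\<close>, once it is calibrated at a vector \<open>y\<close> on which \<open>F\<close> is known.\<close>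

lemma F_ratio:
  assumes i: "i \<noteq> a" "i \<noteq> k" and x: "x$k \<noteq> 0"
    and y: "y \<noteq> 0" "y$k = 1" "y$i = 1" "par (F y) y"
  shows "F x $ i = h (x$i / x$k) * F x $ k"
proof -
  define B where "B = rank_one (e a) (e k) + rank_one (e i) (e i)"
  have B: "B *v z = z$k *s e a + z$i *s e i" for z
    by (simp add: B_def matrix_vector_mult_add_rdistrib rank_one_mult_vec)
  have Bk: "B *v e k = 1 *s e a" and Bi: "B *v e i = 1 *s e i" using i by (simp_all add: B e_nth)
  obtain l where l: "l \<noteq> 0" "\<Psi> B *v e k = l *s e a" using \<Psi>_axis_smult[OF Bk] by auto
  obtain m where m: "m \<noteq> 0" "\<Psi> B *v e i = m *s e i" using \<Psi>_axis_smult[OF Bi] by auto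
  have \<Psi>B: "\<Psi> B *v v = (v$k * l) *s e a + (v$i * m) *s e i" for v
  proof -
    have "\<Psi> B *v v = v$k *s (\<Psi> B *v e k) + v$i *s (\<Psi> B *v e i)"
      by (rule \<Psi>_two_axes) (use i in \<open>auto simp: B e_nth\<close>)
    then show ?thesis by (simp add: l m vector_smult_assoc)
  qed
  have key: "F v $ i * m = h (v$i / v$k) * (F v $ k * l)" if v: "v$k \<noteq> 0" for v
  proof -
    have v0: "v \<noteq> 0" using v by auto
    have "B *v v \<noteq> 0" unfolding B by (metis i(1) line_nth v zero_index)
    from intertwines[OF v0 this]
    have "par (F (v$k *s e a + v$i *s e i)) ((F v $ k * l) *s e a + (F v $ i * m) *s e i)"
      by (simp add: B \<Psi>B)
    from hh_eqI(2)[OF i(1) v this] show ?thesis using hh_h[OF i(1)] by simp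
  qed
  obtain c where c: "c \<noteq> 0" "F y = c *s y" using y(4) par_sym par_expand by blast
  have "m = l" using key[of y] y c by (simp add: h_1)
  then show ?thesis using key[OF x] l(1) by simp
qed

text \<open>When \<open>x$a\<close> is nonzero, the frame points calibrate all ratios to coordinate
  \<open>a\<close>. This case then supplies the calibrating vectors for points with
  \<open>x$a = 0\<close>.\<close>

lemma F_coordinates:
  assumes "x \<noteq> 0"
  shows "par (F x) (hvec h x)"
proof -
  have main: "par (F x) (hvec h x)"
    if xk: "x$k \<noteq> 0" and r: "\<And>i. F x $ i = h (x$i / x$k) * F x $ k" for x k
  proof -
    have "hvec h x = (h (x$k) / F x $ k) *s F x"
      unfolding vec_eq_iff
    proof
      fix i
      show "hvec h x $ i = ((h (x$k) / F x $ k) *s F x) $ i"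
        using r[of i] F_nth_nz[OF xk] h_divide_mult[OF xk, of "x$i"] by (simp add: hvec_def mult.commute)
    qed
    then show ?thesis using par_smult[of "h (x$k) / F x $ k"] F_nth_nz[OF xk] xk h_eq_0 by simp
  qed
  have case_a: "par (F x) (hvec h x)" if xa: "x$a \<noteq> 0" for x
  proof (rule main[OF xa])
    fix i
    show "F x $ i = h (x$i / x$a) * F x $ a"
    proof (cases "i = a")
      case True
      then show ?thesis using xa by (simp add: h_1)
    next
      case False
      show ?thesis
      proof (rule F_ratio[OF False False xa, of "e a + e i"])
        show "(e a + e i) $ a = 1" "(e a + e i) $ i = 1" using False by (simp_all add: e_nth)
        then show "e a + e i \<noteq> 0" by (metis zero_index zero_neq_one)
        show "par (F (e a + e i)) (e a + e i)" by (rule F_frame[OF False])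
      qed
    qed
  qed
  show ?thesis
  proof (cases "x$a = 0")
    case True
    obtain k where k: "x$k \<noteq> 0" using assms by (metis vec_eq_iff zero_index)
    then have ka: "k \<noteq> a" using True by auto
    show ?thesis
    proof (rule main[OF k])
      fix i
      consider "i = k" | "i = a" | "i \<noteq> k" "i \<noteq> a" by blast
      then show "F x $ i = h (x$i / x$k) * F x $ k"
      proof cases
        case 1
        then show ?thesis using k by (simp add: h_1)
      next
        case 2
        then show ?thesis using True F_nth_0[OF True assms] by (simp add: h_0)
      next
        case 3
        \<comment> \<open>Coordinates \<open>k\<close> and \<open>i\<close> must be calibrated at a
          vector where both are 1. The summand \<open>e a\<close> brings it under
          \<open>case_a\<close>, so its image is known.\<close>
        define y where "y = e a + e k + e i"
        have y: "y$a = 1" "y$k = 1" "y$i = 1" using 3 ka by (simp_all add: y_def e_nth)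
        have "hvec h y = y"
          by (auto simp: vec_eq_iff hvec_def y_def e_nth h_0 h_1 ka 3)
        then have "par (F y) y" using case_a[of y] y by simp
        moreover have "y \<noteq> 0" using y by (metis zero_index zero_neq_one)
        ultimately show ?thesis using F_ratio[OF 3(2,1) k, of y] y by blast
      qed
    qed
  qed (rule case_a)
qed

end

section \<open>Orthogonality preserving projective maps\<close>

text \<open>Squares go to squares, so \<open>H\<close> is monotone; it fixes the rationals, which
  are dense.\<close>

lemma real_field_hom_id:
  fixes H :: "real \<Rightarrow> real"
  assumes add: "\<And>x y. H (x + y) = H x + H y" and mult: "\<And>x y. H (x * y) = H x * H y"
    and one: "H 1 = 1"
  shows "H r = r"
proof -
  have zero: "H 0 = 0" using add[of 0 0] by simp
  have minus: "H (- x) = - H x" for x using add[of x "-x"] zero by simp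
  have diff: "H (x - y) = H x - H y" for x y using add[of x "-y"] minus by simp
  have nat: "H (real n) = real n" for n by (induction n) (simp_all add: zero add one)
  have int: "H (of_int k) = of_int k" for k
    by (cases k rule: int_cases2) (simp_all add: nat minus)
  have rat: "H q = q" if "q \<in> \<rat>" for q
  proof -
    obtain m n where mn: "n > 0" "q = of_int m / of_int n"
      using \<open>q \<in> \<rat>\<close> by (rule Rats_cases')
    then have "H q * of_int n = of_int m" using mult[of q "of_int n"] by (simp add: int)
    then have "H q * of_int n = q * of_int n" using mn by simp
    then show ?thesis using mn(1) by simp
  qed
  have pos: "H x \<ge> 0" if "x \<ge> 0" for x
    using mult[of "sqrt x" "sqrt x"] that by simp
  show ?thesis
  proof (rule ccontr)
    assume "H r \<noteq> r"
    then consider "H r < r" | "r < H r" by linarith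
    then show False
    proof cases
      case 1
      then obtain q where "q \<in> \<rat>" "H r < q" "q < r" using Rats_dense_in_real by blast
      then show False using pos[of "r - q"] rat[of q] by (simp add: diff)
    next
      case 2
      then obtain q where "q \<in> \<rat>" "r < q" "q < H r" using Rats_dense_in_real by blast
      then show False using pos[of "q - r"] rat[of q] by (simp add: diff)
    qed
  qed
qed

text \<open>Commuting with \<open>cnj\<close> sends reals to reals, where only the identity is
  possible; this excludes wild automorphisms and leaves the two square roots of -1 as images of
  \<open>\<i>\<close>.\<close>

lemma complex_field_hom_commutes_cnj:
  fixes h :: "complex \<Rightarrow> complex"
  assumes add: "\<And>x y. h (x + y) = h x + h y" and mult: "\<And>x y. h (x * y) = h x * h y"
    and one: "h 1 = 1" and cnj: "\<And>x. h (cnj x) = cnj (h x)"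
  shows "h = (\<lambda>z. z) \<or> h = cnj"
proof -
  define H where "H r = Re (h (of_real r))" for r
  have hH: "h (of_real r) = of_real (H r)" for r
  proof -
    have "cnj (h (of_real r)) = h (of_real r)" using cnj[of "of_real r"] by simp
    then have "Im (h (of_real r)) = 0" by (simp add: complex_eq_iff)
    then show ?thesis by (simp add: H_def complex_eq_iff)
  qed
  have "H r = r" for r
  proof (rule real_field_hom_id)
    show "H (x + y) = H x + H y" for x y by (simp add: H_def add)
    show "H (x * y) = H x * H y" for x y
      using mult[of "of_real x" "of_real y"] by (simp add: hH flip: of_real_mult)
    show "H 1 = 1" by (simp add: H_def one)
  qed
  then have real: "h (of_real r) = of_real r" for r using hH by simp
  have "h (\<i> * \<i>) = h (of_real (-1))" by simp
  then have "h \<i> * h \<i> = -1" unfolding mult real by simp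
  then have "(h \<i> - \<i>) * (h \<i> + \<i>) = 0" by (simp add: algebra_simps)
  then have ii: "h \<i> = \<i> \<or> h \<i> = - \<i>" by (auto simp: eq_neg_iff_add_eq_0)
  have dec: "h z = of_real (Re z) + h \<i> * of_real (Im z)" for z
    using add[of "of_real (Re z)" "\<i> * of_real (Im z)"] mult[of \<i> "of_real (Im z)"] real
    by (simp flip: complex_eq)
  show ?thesis using ii
  proof
    assume "h \<i> = \<i>"
    then have "h z = z" for z using dec[of z] by (simp add: complex_eq_iff)
    then show ?thesis by blast
  next
    assume "h \<i> = - \<i>"
    then have "h z = cnj z" for z using dec[of z] by (simp add: complex_eq_iff)
    then show ?thesis by blast
  qed
qed

text \<open>Values of \<open>f\<close> matter only up to scalars. In the application
  \<open>f\<close> acts on left factors, and \<open>\<Psi> B\<close> is \<open>\<Phi> B\<close>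
  followed on the right by the adjoint of a unitary.\<close>

locale orth_projective_map =
  fixes f :: "complex^'n \<Rightarrow> complex^'n"
    and \<Psi> :: "complex^'n^'n \<Rightarrow> complex^'n^'n"
  assumes dim: "CARD('n) \<ge> 2"
    and f_nz: "x \<noteq> 0 \<Longrightarrow> f x \<noteq> 0"
    and f_surj: "p \<noteq> 0 \<Longrightarrow> \<exists>x. x \<noteq> 0 \<and> par p (f x)"
    and f_orth: "x \<noteq> 0 \<Longrightarrow> y \<noteq> 0 \<Longrightarrow> cinner (f x) (f y) = 0 \<longleftrightarrow> cinner x y = 0"
    and f_intertwines_0: "y \<noteq> 0 \<Longrightarrow> B *v y = 0 \<Longrightarrow> \<Psi> B *v f y = 0"
    and f_intertwines: "y \<noteq> 0 \<Longrightarrow> B *v y \<noteq> 0 \<Longrightarrow> par (f (B *v y)) (\<Psi> B *v f y)"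
begin

text \<open>Orthogonality alone separates lines; that \<open>f\<close> is well defined on lines uses
  that the vectors \<open>f z\<close> exhaust all lines.\<close>

lemma f_par:
  assumes "x \<noteq> 0" "y \<noteq> 0"
  shows "par (f x) (f y) \<longleftrightarrow> par x y"
proof
  assume "par (f x) (f y)"
  then have "cinner z x = 0 \<longleftrightarrow> cinner z y = 0" for z
    using f_orth[of z x] f_orth[of z y] assms unfolding par_iff_orth[of "f x"]
    by (cases "z = 0") (auto simp: cinner_simps)
  then show "par x y" using par_iff_orth by blast
next
  assume xy: "par x y"
  have "cinner p (f x) = 0 \<longleftrightarrow> cinner p (f y) = 0" for p
  proof (cases "p = 0")
    case False
    then obtain z where z: "z \<noteq> 0" "par p (f z)" using f_surj by blast
    have "cinner p (f u) = 0 \<longleftrightarrow> cinner z u = 0" if "u \<noteq> 0" for u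
      using par_cinner_eq_0[OF z(2) par_refl, of "f u"] f_orth[OF z(1) that] by simp
    then show ?thesis using assms xy par_iff_orth by blast
  qed (simp add: cinner_simps)
  then show "par (f x) (f y)" using par_iff_orth by blast
qed

lemma representation:
  "\<exists>T h. (h = (\<lambda>z. z) \<or> h = cnj) \<and> (\<forall>x. x \<noteq> 0 \<longrightarrow> par (f x) (T *v hvec h x))"
proof -
  let ?e = "\<lambda>i. axis i 1 :: complex^'n"
  have e0: "?e i \<noteq> 0" for i by (simp add: axis_eq_0_iff)
  have e_nth: "?e i $ j = (if j = i then 1 else 0)" for i j by (simp add: axis_def)
  obtain a o' :: 'n where other: "o' \<noteq> a" using dim by (metis UNIV_I card_2_iff' ex_card)
  \<comment> \<open>The coefficients of \<open>f (e a + e i)\<close> along \<open>f (e a)\<close>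
    and \<open>f (e i)\<close> are \<open>s i\<close> and \<open>t i\<close>. Rescaling the latter
    by t / s makes \<open>f (e a + e i)\<close> a multiple of \<open>b a + b i\<close>, so in the
    basis \<open>b\<close> the frame is fixed.\<close>
  define s where "s i = cinner (f (?e a)) (f (?e a + ?e i)) / cinner (f (?e a)) (f (?e a))" for i
  define t where "t i = cinner (f (?e i)) (f (?e a + ?e i)) / cinner (f (?e i)) (f (?e i))" for i
  define k where "k i = (if i = a then 1 else t i / s i)" for i
  define b where "b i = k i *s f (?e i)" for i
  have ai0: "?e a + ?e i \<noteq> 0" if "i \<noteq> a" for i
  proof -
    have "(?e a + ?e i) $ a = 1" using that by (simp add: e_nth)
    then show ?thesis by (metis zero_index zero_neq_one)
  qed
  have st: "s i \<noteq> 0" "t i \<noteq> 0" if "i \<noteq> a" for i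
    using that f_nz[OF e0] f_orth[OF e0 ai0[OF that]]
    by (simp_all add: s_def t_def cinner_self_eq_0 e_nth cinner_simps)
  have k0: "k i \<noteq> 0" for i using st by (simp add: k_def)
  have par_b: "par (f (?e i)) (b i)" for i unfolding b_def using k0 par_smult by blast
  have b0: "b i \<noteq> 0" for i using par_eq_0[OF par_b] f_nz[OF e0] by blast
  have b_orth: "cinner (b i) (f x) = 0 \<longleftrightarrow> x$i = 0" if "x \<noteq> 0" for i x
    using par_cinner_eq_0[OF par_b par_refl, of i "f x"] f_orth[OF e0 that, of i] by simp
  have bb: "cinner (b i) (b j) = 0" if "i \<noteq> j" for i j
    using par_cinner_eq_0[OF par_b par_b, of i j] f_orth[OF e0 e0, of i j] that by (simp add: e_nth)
  define w where "w i = cinner (b i) (b i)" for i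
  have w0: "w i \<noteq> 0" for i by (simp add: w_def cinner_self_eq_0 b0)
  define T :: "complex^'n^'n" where "T = (\<chi> r j. b j $ r)"
  \<comment> \<open>The vectors \<open>b j\<close> are orthogonal, so the inverse of
    \<open>T\<close> is explicit.\<close>
  define S :: "complex^'n^'n" where "S = (\<chi> j r. cnj (b j $ r) / w j)"
  have S_nth: "(S *v v) $ j = cinner (b j) v / w j" for v j
    by (simp add: S_def matrix_vector_mult_def cinner_def sum_divide_distrib)
  have T_e: "T *v ?e j = b j" for j
    by (simp add: T_def vec_eq_iff matrix_vector_mult_def e_nth if_distrib cong: if_cong)
  have "S ** T = mat 1"
  proof -
    have "(S ** T) $ i $ j = (mat 1 :: complex^'n^'n) $ i $ j" for i j
    proof -
      have "(S ** T) $ i $ j = (\<Sum>r\<in>UNIV. cnj (b i $ r) / w i * b j $ r)"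
        by (simp add: matrix_matrix_mult_def S_def T_def)
      also have "\<dots> = cinner (b i) (b j) / w i" by (simp add: cinner_def sum_divide_distrib)
      also have "\<dots> = (mat 1 :: complex^'n^'n) $ i $ j"
        using bb[of i j] w0[of i] by (auto simp: mat_def w_def)
      finally show ?thesis .
    qed
    then show ?thesis by (simp add: vec_eq_iff)
  qed
  then have "T ** S = mat 1" using matrix_left_right_inverse by blast
  then have TS: "T *v (S *v v) = v" for v by (simp add: matrix_vector_mul_assoc)
  define F where "F x = S *v f x" for x
  have TF: "T *v F x = f x" for x by (simp add: F_def TS)
  have F_nth: "F x $ j = cinner (b j) (f x) / w j" for x j by (simp add: F_def S_nth)
  define \<Psi>' where "\<Psi>' B = S ** \<Psi> B ** T" for B
  have \<Psi>'F: "\<Psi>' B *v F y = S *v (\<Psi> B *v f y)" for B y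
    by (simp add: \<Psi>'_def TF flip: matrix_vector_mul_assoc)
  have parF: "par (F x) (F y) \<longleftrightarrow> par (f x) (f y)" for x y
    using par_mult_vec[of "F x" "F y" T] par_mult_vec[of "f x" "f y" S] by (auto simp: TF F_def TS)
  interpret framed_projective_map F \<Psi>' a
  proof
    fix y :: "complex^'n" and B :: "complex^'n^'n" assume y: "y \<noteq> 0"
    { assume "B *v y = 0"
      then show "\<Psi>' B *v F y = 0" using f_intertwines_0[OF y] by (simp add: \<Psi>'F) }
    { assume "B *v y \<noteq> 0"
      then show "par (F (B *v y)) (\<Psi>' B *v F y)"
        unfolding \<Psi>'F using par_mult_vec[OF f_intertwines[OF y], of B S] by (simp add: F_def) }
  next
    fix x :: "complex^'n" and c :: complex assume "x \<noteq> 0" "c \<noteq> 0"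
    then show "par (F x) (F (c *s x))" unfolding parF by (subst f_par) (simp_all add: par_smult)
  next
    fix x y :: "complex^'n" assume "x \<noteq> 0" "y \<noteq> 0" "par (F x) (F y)"
    then show "par x y" by (simp add: parF f_par)
  next
    fix i
    have "F (?e i) = F (?e i) $ i *s ?e i"
      unfolding vec_eq_iff by (simp add: e_nth F_nth b_orth[OF e0])
    moreover have "F (?e i) $ i \<noteq> 0" using w0 b_orth[OF e0] by (simp add: F_nth e_nth)
    ultimately show "par (F (?e i)) (?e i)" using par_smult par_sym by metis
  next
    fix i assume i: "i \<noteq> a"
    let ?x = "?e a + ?e i"
    have "F ?x $ a = s i" by (simp add: F_nth w_def b_def k_def s_def)
    moreover have "F ?x $ i = s i"
    proof -
      have "F ?x $ i = (cnj (k i) * cinner (f (?e i)) (f ?x)) / (cnj (k i) * (k i * cinner (f (?e i)) (f (?e i))))"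
        by (simp add: F_nth w_def b_def cinner_simps)
      also have "\<dots> = t i / k i" using k0[of i] by (simp add: t_def)
      also have "\<dots> = s i" using i st by (simp add: k_def)
      finally show ?thesis .
    qed
    moreover have "F ?x $ j = 0" if "j \<noteq> a" "j \<noteq> i" for j
      using that b_orth[OF ai0[OF i], of j] by (simp add: F_nth e_nth)
    ultimately have "F ?x = s i *s ?x"
      unfolding vec_eq_iff using i by (simp add: e_nth)
    then show "par (F ?x) ?x" using par_smult st[OF i] par_sym by metis
  next
    show "\<exists>i. i \<noteq> a" using other by blast
  qed
  have rep: "par (f x) (T *v hvec h x)" if "x \<noteq> 0" for x
    using par_mult_vec[OF F_coordinates[OF that], of T] by (simp add: TF)
  have orth2: "cnj (h p) * h p' * w a + cnj (h q) * h q' * w o' = 0"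
    if 0: "cnj p * p' + cnj q * q' = 0" and nz: "p \<noteq> 0 \<or> q \<noteq> 0" "p' \<noteq> 0 \<or> q' \<noteq> 0" for p q p' q'
  proof -
    define x y where "x = p *s ?e a + q *s ?e o'" and "y = p' *s ?e a + q' *s ?e o'"
    have "x$a = p" "x$o' = q" "y$a = p'" "y$o' = q'" using other by (simp_all add: x_def y_def e_nth)
    then have xy0: "x \<noteq> 0" "y \<noteq> 0" using nz by (metis zero_index)+
    have "cinner x y = 0" using 0 other by (simp add: x_def y_def cinner_simps e_nth mult.commute)
    then have "cinner (f x) (f y) = 0" using f_orth xy0 by blast
    then have o: "cinner (T *v hvec h x) (T *v hvec h y) = 0"
      using par_cinner_eq_0[OF rep[OF xy0(1)] rep[OF xy0(2)]] by blast
    have hv: "T *v hvec h (p *s ?e a + q *s ?e o') = h p *s b a + h q *s b o'" for p q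
    proof -
      have "hvec h (p *s ?e a + q *s ?e o') = h p *s ?e a + h q *s ?e o'"
        using other by (auto simp: vec_eq_iff hvec_def e_nth h_0)
      then show ?thesis by (simp add: matrix_vector_right_distrib mult_vec_smult T_e)
    qed
    show ?thesis
      using o bb[OF other] bb[OF other[symmetric]]
      by (simp add: x_def y_def hv cinner_simps w_def algebra_simps)
  qed
  \<comment> \<open>The vectors (1, 1) and (1, -1) are orthogonal, so the two weights agree.\<close>
  have ww: "w a = w o'" using orth2[of 1 1 1 "-1"] by (simp add: h_1 h_minus)
  have "h (cnj c) = cnj (h c)" for c
    \<comment> \<open>The vectors (1, -cnj c) and (c, 1) are orthogonal; with equal weights this
      reads h c = cnj (h (cnj c)).\<close>
    using orth2[of 1 "- cnj c" c 1] w0[of a] ww by (simp add: h_1 h_minus)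
  then have "h = (\<lambda>z. z) \<or> h = cnj"
    by (intro complex_field_hom_commutes_cnj h_add h_mult h_1)
  then show ?thesis using rep by blast
qed

end

section \<open>Unitary matrices and zero sets of sesquilinear forms\<close>

definition unitary :: "complex^'n^'n \<Rightarrow> bool" where
  "unitary U \<longleftrightarrow> adjoint_mat U ** U = mat 1"

lemma adjoint_mult: "adjoint_mat (A ** B) = adjoint_mat B ** adjoint_mat A"
  by (simp add: adjoint_mat_def matrix_matrix_mult_def vec_eq_iff mult.commute)

lemma unitary_adjoint: "unitary U \<Longrightarrow> unitary (adjoint_mat U)"
  by (simp add: unitary_def matrix_left_right_inverse)

lemma unitary_mult_adjoint: "unitary U \<Longrightarrow> U ** adjoint_mat U = mat 1"
  by (simp add: unitary_def matrix_left_right_inverse)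

lemma unitary_mult: "unitary U \<Longrightarrow> unitary V \<Longrightarrow> unitary (U ** V)"
  unfolding unitary_def adjoint_mult by (metis matrix_mul_assoc matrix_mul_rid)

lemma unitary_norm:
  assumes "unitary U"
  shows "norm (U *v x) = norm x"
proof -
  have "cinner (U *v x) (U *v x) = cinner x x"
    using assms by (simp add: cinner_adjoint_left matrix_vector_mul_assoc unitary_def)
  then have "(norm (U *v x))\<^sup>2 = (norm x)\<^sup>2" unfolding cinner_self using of_real_eq_iff by blast
  then show ?thesis by simp
qed

lemma opnorm_unitary_left:
  assumes "unitary U"
  shows "opnorm (U ** A) = opnorm A"
  by (simp add: opnorm_def unitary_norm[OF assms] onorm_def flip: matrix_vector_mul_assoc)

lemma opnorm_unitary_right:
  assumes "unitary U"
  shows "opnorm (A ** U) = opnorm A"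
  using opnorm_unitary_left[OF unitary_adjoint[OF assms], of "adjoint_mat A"]
  by (simp add: opnorm_adjoint flip: adjoint_mult)

text \<open>Splitting \<open>y\<close> along \<open>x\<close> shows that \<open>M\<close> multiplies
  every inner product with \<open>x\<close> by the stretch factor \<open>r x\<close>. Exchanging the
  arguments equates the factors of nonorthogonal vectors, and x + y links orthogonal ones, so the
  factor is constant.\<close>

lemma orth_preserving_matrix:
  assumes orth: "\<And>x y. cinner x y = 0 \<Longrightarrow> cinner (M *v x) (M *v y) = 0" and "M \<noteq> 0"
  shows "\<exists>k U. k \<noteq> 0 \<and> unitary U \<and> M = msmul k U"
proof -
  define r where "r x = cinner (M *v x) (M *v x) / cinner x x" for x
  have r: "cinner (M *v x) (M *v y) = r x * cinner x y" if "x \<noteq> 0" for x y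
  proof -
    define c where "c = cinner x y / cinner x x"
    define z where "z = y - c *s x"
    have "cinner x z = 0" using that by (simp add: z_def c_def cinner_simps cinner_self_eq_0)
    then have "cinner (M *v x) (M *v z) = 0" by (rule orth)
    then show ?thesis
      by (simp add: z_def matrix_vector_mult_diff_distrib mult_vec_smult cinner_simps r_def c_def)
  qed
  have real: "cnj (r x) = r x" for x by (simp add: r_def cnj_cinner)
  have step: "r x = r y" if "x \<noteq> 0" "y \<noteq> 0" "cinner x y \<noteq> 0" for x y
  proof -
    have "r x * cinner x y = cnj (r y * cinner y x)"
      using r[OF that(1), of y] r[OF that(2), of x] cnj_cinner by metis
    then show ?thesis using that(3) real by (simp add: cnj_cinner)
  qed
  have const: "r x = r y" if "x \<noteq> 0" "y \<noteq> 0" for x y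
  proof (cases "cinner x y = 0")
    case True
    then have yx: "cinner y x = 0" using cinner_eq_0_commute by blast
    have "cinner x (x + y) \<noteq> 0" "cinner (x + y) y \<noteq> 0"
      using True that by (simp_all add: cinner_simps cinner_self_eq_0)
    moreover from this have "x + y \<noteq> 0" by (metis cinner_simps(8))
    ultimately show ?thesis using step that by metis
  qed (use step that in blast)
  obtain u where u: "M *v u \<noteq> 0" using \<open>M \<noteq> 0\<close> matrix_eqI_vec[of M 0] by auto
  then have u0: "u \<noteq> 0" by auto
  define w where "w = (norm (M *v u) / norm u)\<^sup>2"
  have ru: "r u = of_real w" by (simp add: r_def w_def cinner_self power_divide)
  have w: "w > 0" using u u0 by (simp add: w_def)
  have M: "cinner (M *v x) (M *v y) = of_real w * cinner x y" for x y
    using r[of x y] const[OF _ u0, of x] ru by (cases "x = 0") (auto simp: cinner_simps)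
  define k where "k = complex_of_real (sqrt w)"
  have k0: "k \<noteq> 0" and kk: "cnj k * k = of_real w"
    using w by (simp_all add: k_def flip: of_real_mult)
  define U where "U = msmul (1 / k) M"
  have MU: "M = msmul k U" using k0 by (simp add: U_def msmul_msmul)
  have "cinner x (adjoint_mat U *v (U *v y)) = cinner x y" for x y
  proof -
    have "cinner (U *v x) (U *v y) = cinner (M *v x) (M *v y) / (cnj k * k)"
      by (simp add: U_def msmul_mult_vec cinner_simps)
    also have "\<dots> = cinner x y" unfolding M kk using w by simp
    finally show ?thesis by (simp add: cinner_adjoint_left)
  qed
  then have "adjoint_mat U *v (U *v y) = y" for y by (rule cinner_right_eqI)
  then have "unitary U"
    unfolding unitary_def by (intro matrix_eqI_vec) (simp flip: matrix_vector_mul_assoc)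
  then show ?thesis using k0 MU by blast
qed

text \<open>Pointwise \<open>A y\<close> and \<open>B y\<close> are proportional. Independent images
  share their factor by comparison at \<open>y + u\<close>; if \<open>A y\<close> is a multiple of
  \<open>A u\<close>, the common kernel of \<open>A\<close> and \<open>B\<close> settles it, which
  also covers \<open>A\<close> of rank one.\<close>

lemma zeros_determine_matrix:
  assumes "\<And>x y. cinner x (A *v y) = 0 \<longleftrightarrow> cinner x (B *v y) = 0"
  shows "\<exists>c. c \<noteq> 0 \<and> B = msmul c A"
proof (cases "A = 0")
  case True
  then have "par (0::complex^'a) (B *v y)" for y
    unfolding par_iff_orth using assms[of _ y] by (simp add: cinner_simps)
  then have "B *v y = 0" for y using par_eq_0 by blast
  then have "B = 0" by (intro matrix_eqI_vec) simp
  then show ?thesis using True by (intro exI[of _ 1]) simp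
next
  case False
  have par: "par (A *v y) (B *v y)" for y unfolding par_iff_orth using assms by blast
  obtain u where u: "A *v u \<noteq> 0" using False matrix_eqI_vec[of A 0] by auto
  obtain c where c: "c \<noteq> 0" "B *v u = c *s (A *v u)" using par par_def by metis
  have "B *v y = c *s (A *v y)" for y
  proof (cases "\<exists>k. A *v y = k *s (A *v u)")
    case True
    then obtain k where k: "A *v y = k *s (A *v u)" by blast
    then have "A *v (y - k *s u) = 0" by (simp add: matrix_vector_mult_diff_distrib mult_vec_smult)
    then have "B *v (y - k *s u) = 0" using par par_eq_0 by metis
    then have "B *v y = k *s (B *v u)" by (simp add: matrix_vector_mult_diff_distrib mult_vec_smult)
    then show ?thesis by (simp add: c k vector_smult_assoc mult.commute)
  next
    case indep: False
    obtain d where d: "d \<noteq> 0" "B *v y = d *s (A *v y)" using par par_def by metis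
    obtain l where l: "l \<noteq> 0" "B *v (y + u) = l *s (A *v (y + u))" using par par_def by metis
    have eq: "(d - l) *s (A *v y) = (l - c) *s (A *v u)"
    proof -
      have "d *s (A *v y) + c *s (A *v u) = l *s (A *v y) + l *s (A *v u)"
        using l(2) by (simp add: matrix_vector_right_distrib d c vector_add_ldistrib)
      moreover have "p - q = r - s" if "p + s = q + r" for p q r s :: "complex^'a"
        using that by (simp add: algebra_simps)
      ultimately show ?thesis unfolding vector_sub_rdistrib by blast
    qed
    have "d = l"
    proof (rule ccontr)
      assume "d \<noteq> l"
      then have "A *v y = (1 / (d - l)) *s ((d - l) *s (A *v y))"
        by (simp only: vector_smult_assoc) simp
      then have "A *v y = (1 / (d - l) * (l - c)) *s (A *v u)" unfolding eq vector_smult_assoc .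
      then show False using indep by blast
    qed
    then have "l = c" using eq u by simp
    then show ?thesis using d \<open>d = l\<close> by simp
  qed
  then have "B = msmul c A" by (intro matrix_eqI_vec) (simp add: msmul_mult_vec)
  then show ?thesis using c by blast
qed

section \<open>Entrywise conjugation\<close>

definition hmat :: "(complex \<Rightarrow> complex) \<Rightarrow> complex^'n^'n \<Rightarrow> complex^'n^'n" where
  "hmat h A = (\<chi> i j. h (A$i$j))"

lemma hvec_simps:
  assumes "h = (\<lambda>z. z) \<or> h = cnj"
  shows "hvec h (hvec h x) = x" "hmat h A *v hvec h x = hvec h (A *v x)"
    "cinner (hvec h x) (hvec h y) = h (cinner x y)" "h c = 0 \<longleftrightarrow> c = 0"
    "norm (hvec h x) = norm x" "hvec h x = 0 \<longleftrightarrow> x = 0"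
proof -
  show "hvec h (hvec h x) = x" "hmat h A *v hvec h x = hvec h (A *v x)"
    "cinner (hvec h x) (hvec h y) = h (cinner x y)"
    using assms by (elim disjE; simp add: hvec_def hmat_def vec_eq_iff matrix_vector_mult_def cinner_def)+
  show "h c = 0 \<longleftrightarrow> c = 0" using assms by (elim disjE; simp)
  show "norm (hvec h x) = norm x" "hvec h x = 0 \<longleftrightarrow> x = 0"
    using assms by (elim disjE; simp add: hvec_def vec_eq_iff norm_vec_def)+
qed

lemma opnorm_hmat:
  assumes "h = (\<lambda>z. z) \<or> h = cnj"
  shows "opnorm (hmat h A) = opnorm A"
proof -
  have le: "opnorm (hmat h A) \<le> opnorm A" for A :: "complex^'n^'n"
  proof (rule opnorm_bound[OF opnorm_nonneg])
    fix x :: "complex^'n"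
    have "hmat h A *v x = hvec h (A *v hvec h x)"
      by (metis hvec_simps(1,2)[OF assms])
    then show "norm (hmat h A *v x) \<le> opnorm A * norm x"
      using norm_mult_vec_le[of A "hvec h x"] by (simp add: hvec_simps[OF assms])
  qed
  have "hmat h (hmat h A) = A" using assms by (auto simp: hmat_def vec_eq_iff)
  then show ?thesis using le[of A] le[of "hmat h A"] by simp
qed

section \<open>The structure theorem\<close>

text \<open>The scalar is on the side of the isometry here; the theorem uses its reciprocal.\<close>

definition proportional_to_isometry :: "(complex^'n^'n \<Rightarrow> complex^'n^'n) \<Rightarrow> bool" where
  "proportional_to_isometry \<Phi> \<longleftrightarrow> (\<exists>L.
     (\<forall>X Y. L (X + Y) = L X + L Y) \<and>
     ((\<forall>c X. L (msmul c X) = msmul c (L X)) \<or> (\<forall>c X. L (msmul c X) = msmul (cnj c) (L X))) \<and>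
     (\<forall>X. opnorm (L X) = opnorm X) \<and>
     (\<forall>X. \<exists>c. c \<noteq> 0 \<and> \<Phi> X = msmul c (L X)))"

lemma proportional_to_isometry_adjoint:
  assumes "proportional_to_isometry (\<lambda>X. adjoint_mat (\<Phi> X))"
  shows "proportional_to_isometry \<Phi>"
proof -
  obtain L where L: "\<And>X Y. L (X + Y) = L X + L Y"
    "(\<forall>c X. L (msmul c X) = msmul c (L X)) \<or> (\<forall>c X. L (msmul c X) = msmul (cnj c) (L X))"
    "\<And>X. opnorm (L X) = opnorm X"
    "\<And>X. \<exists>c. c \<noteq> 0 \<and> adjoint_mat (\<Phi> X) = msmul c (L X)"
    using assms unfolding proportional_to_isometry_def by blast
  define L' where "L' X = adjoint_mat (L X)" for X
  have "\<exists>c. c \<noteq> 0 \<and> \<Phi> X = msmul c (L' X)" for X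
  proof -
    obtain c where c: "c \<noteq> 0" "adjoint_mat (\<Phi> X) = msmul c (L X)" using L(4) by blast
    have "\<Phi> X = adjoint_mat (msmul c (L X))" by (simp flip: c(2))
    then show ?thesis using c(1) by (intro exI[of _ "cnj c"]) (simp add: adjoint_msmul L'_def)
  qed
  moreover have "(\<forall>c X. L' (msmul c X) = msmul c (L' X)) \<or> (\<forall>c X. L' (msmul c X) = msmul (cnj c) (L' X))"
    using L(2) by (auto simp: L'_def adjoint_msmul)
  moreover have "L' (X + Y) = L' X + L' Y" "opnorm (L' X) = opnorm X" for X Y
    by (simp_all add: L'_def L adjoint_add opnorm_adjoint)
  ultimately show ?thesis
    unfolding proportional_to_isometry_def by (intro exI[of _ L'] conjI allI) blast+
qed

lemma bj_orth_adjoint: "bj_orth (adjoint_mat A) (adjoint_mat B) \<longleftrightarrow> bj_orth A B"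
proof -
  have "adjoint_mat A + msmul t (adjoint_mat B) = adjoint_mat (A + msmul (cnj t) B)" for t
    by (simp add: adjoint_add adjoint_msmul)
  then have "bj_orth (adjoint_mat A) (adjoint_mat B) \<longleftrightarrow> (\<forall>t. opnorm A \<le> opnorm (A + msmul (cnj t) B))"
    by (simp add: bj_orth_def opnorm_adjoint)
  also have "\<dots> \<longleftrightarrow> bj_orth A B" unfolding bj_orth_def by (metis complex_cnj_cnj)
  finally show ?thesis .
qed

context bj_isomorphism
begin

lemma bj_isomorphism_adjoint: "bj_isomorphism (\<lambda>X. adjoint_mat (\<Phi> X))"
proof
  have "bij adjoint_mat" by (rule involuntory_imp_bij) simp
  then show "bij (\<lambda>X. adjoint_mat (\<Phi> X))" using bij_comp[OF bij] by (simp add: o_def)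
qed (simp_all add: dim bj_orth_adjoint orth_iff)

lemma row_preserving_proportional_to_isometry:
  assumes rows: "\<And>x y y'. x \<noteq> 0 \<Longrightarrow> y \<noteq> 0 \<Longrightarrow> y' \<noteq> 0 \<Longrightarrow> par (lft x y) (lft x y')"
  shows "proportional_to_isometry \<Phi>"
proof -
  have "\<exists>f g. (\<forall>x. x \<noteq> 0 \<longrightarrow> f x \<noteq> 0) \<and> (\<forall>y. y \<noteq> 0 \<longrightarrow> g y \<noteq> 0) \<and>
    (\<forall>x y. x \<noteq> 0 \<longrightarrow> y \<noteq> 0 \<longrightarrow> par (lft x y) (f x) \<and> par (rgt x y) (g y))"
    by (rule separated_factors) (rule rows)
  then obtain f g where "(\<forall>x. x \<noteq> 0 \<longrightarrow> f x \<noteq> 0) \<and> (\<forall>y. y \<noteq> 0 \<longrightarrow> g y \<noteq> 0) \<and>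
    (\<forall>x y. x \<noteq> 0 \<longrightarrow> y \<noteq> 0 \<longrightarrow> par (lft x y) (f x) \<and> par (rgt x y) (g y))"
    by (elim exE)
  then have f_nz: "\<And>x. x \<noteq> 0 \<Longrightarrow> f x \<noteq> 0" and g_nz: "\<And>y. y \<noteq> 0 \<Longrightarrow> g y \<noteq> 0"
    and lf: "\<And>x y. x \<noteq> 0 \<Longrightarrow> y \<noteq> 0 \<Longrightarrow> par (lft x y) (f x)"
    and rg: "\<And>x y. x \<noteq> 0 \<Longrightarrow> y \<noteq> 0 \<Longrightarrow> par (rgt x y) (g y)"
    by simp_all
  have rel: "cinner (f x) (\<Phi> B *v g y) = 0 \<longleftrightarrow> cinner x (B *v y) = 0" if "x \<noteq> 0" "y \<noteq> 0" for x y B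
  proof -
    have "cinner x (B *v y) = 0 \<longleftrightarrow> bj_orth (\<Phi> (rank_one x y)) (\<Phi> B)"
      using that by (simp add: orth_iff rank_one_bj_orth_iff)
    also have "\<dots> \<longleftrightarrow> cinner (lft x y) (\<Phi> B *v rgt x y) = 0"
      using that by (simp add: image_rank_one rank_one_bj_orth_iff)
    also have "\<dots> \<longleftrightarrow> cinner (f x) (\<Phi> B *v g y) = 0"
      by (rule par_cinner_eq_0[OF lf[OF that] par_mult_vec[OF rg[OF that]]])
    finally show ?thesis by simp
  qed
  define e where "e = (axis undefined 1 :: complex^'n)"
  have e: "e \<noteq> 0" by (simp add: e_def axis_eq_0_iff)
  have f_surj: "\<exists>x. x \<noteq> 0 \<and> par p (f x)" if "p \<noteq> 0" for p
    using factors_surj[OF that e] lf par_trans by blast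
  have g_surj: "\<exists>y. y \<noteq> 0 \<and> par q (g y)" if "q \<noteq> 0" for q
    using factors_surj[OF e that] rg par_trans by blast
  have img: "cinner (f x) (f x') = 0 \<or> cinner (g y) (g y') = 0 \<longleftrightarrow> cinner x x' = 0 \<or> cinner y y' = 0"
    if nz: "x \<noteq> 0" "y \<noteq> 0" "x' \<noteq> 0" "y' \<noteq> 0" for x y x' y'
  proof -
    have "cinner x x' = 0 \<or> cinner y y' = 0 \<longleftrightarrow> bj_orth (\<Phi> (rank_one x y)) (\<Phi> (rank_one x' y'))"
      using nz by (simp add: orth_iff rank_one_bj_orth_rank_one)
    also have "\<dots> \<longleftrightarrow> cinner (lft x y) (lft x' y') = 0 \<or> cinner (rgt x y) (rgt x' y') = 0"
      using nz by (simp add: image_rank_one rank_one_bj_orth_rank_one)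
    also have "\<dots> \<longleftrightarrow> cinner (f x) (f x') = 0 \<or> cinner (g y) (g y') = 0"
      using par_cinner_eq_0[OF lf[OF nz(1,2)] lf[OF nz(3,4)]] par_cinner_eq_0[OF rg[OF nz(1,2)] rg[OF nz(3,4)]]
      by simp
    finally show ?thesis by simp
  qed
  \<comment> \<open>Equal right factors \<open>e\<close> disable the second alternative of
    \<open>img\<close>, since \<open>g e\<close> and \<open>e\<close> are not orthogonal to
    themselves.\<close>
  have f_orth: "cinner (f x) (f x') = 0 \<longleftrightarrow> cinner x x' = 0" if "x \<noteq> 0" "x' \<noteq> 0" for x x'
    using img[OF that(1) e that(2) e] e g_nz by (simp add: cinner_self_eq_0)
  have g_orth: "cinner (g y) (g y') = 0 \<longleftrightarrow> cinner y y' = 0" if "y \<noteq> 0" "y' \<noteq> 0" for y y'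
    using img[OF e that(1) e that(2)] e f_nz by (simp add: cinner_self_eq_0)
  have int0: "\<Phi> B *v g y = 0" if "y \<noteq> 0" "B *v y = 0" for B y
  proof -
    have "cinner p (\<Phi> B *v g y) = cinner p 0" for p
    proof (cases "p = 0")
      case False
      then obtain x where x: "x \<noteq> 0" "par p (f x)" using f_surj by blast
      then show ?thesis
        using rel[OF x(1) that(1), of B] that(2) par_cinner_eq_0[OF x(2) par_refl, of "\<Phi> B *v g y"]
        by (simp add: cinner_simps)
    qed (simp add: cinner_simps)
    then show ?thesis by (rule cinner_right_eqI)
  qed
  \<comment> \<open>Every \<open>p\<close> is on the line of some \<open>f x\<close>, so
    \<open>rel\<close> and \<open>f_orth\<close> describe the hyperplanes orthogonal to the two
    sides by the same condition, \<open>cinner x (B *v y) = 0\<close>.\<close>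
  have int: "par (f (B *v y)) (\<Phi> B *v g y)" if "y \<noteq> 0" "B *v y \<noteq> 0" for B y
    unfolding par_iff_orth
  proof
    fix p
    show "cinner p (f (B *v y)) = 0 \<longleftrightarrow> cinner p (\<Phi> B *v g y) = 0"
    proof (cases "p = 0")
      case False
      then obtain x where x: "x \<noteq> 0" "par p (f x)" using f_surj by blast
      show ?thesis
        using rel[OF x(1) that(1), of B] f_orth[OF x(1) that(2)] par_cinner_eq_0[OF x(2) par_refl]
        by simp
    qed (simp add: cinner_simps)
  qed
  define M where "M = \<Phi> (mat 1)"
  have Mg: "par (f y) (M *v g y)" if "y \<noteq> 0" for y
    using int[OF that, of "mat 1"] that by (simp add: M_def)
  \<comment> \<open>\<open>M\<close> carries the line of \<open>g y\<close> to that of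
    \<open>f y\<close>, every nonzero vector lies on a line of the first kind, and \<open>f\<close>
    and \<open>g\<close> both preserve and reflect orthogonality.\<close>
  have "cinner (M *v p) (M *v q) = 0" if pq: "cinner p q = 0" for p q
  proof (cases "p = 0 \<or> q = 0")
    case False
    then obtain y z where y: "y \<noteq> 0" "par p (g y)" and z: "z \<noteq> 0" "par q (g z)" using g_surj by metis
    have "cinner (f y) (f z) = 0"
      using pq par_cinner_eq_0[OF y(2) z(2)] g_orth[OF y(1) z(1)] f_orth[OF y(1) z(1)] by simp
    moreover have "par (f y) (M *v p)" "par (f z) (M *v q)"
      using Mg y z par_mult_vec par_sym par_trans by blast+
    ultimately show ?thesis using par_cinner_eq_0 by blast
  qed (auto simp: cinner_simps)
  moreover have "M \<noteq> 0" using Mg[OF e] f_nz[OF e] par_eq_0 by fastforce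
  ultimately obtain k U where k: "k \<noteq> 0" and U: "unitary U" and MU: "M = msmul k U"
    using orth_preserving_matrix by blast
  have UU: "adjoint_mat U *v (U *v x) = x" for x
    using U by (simp add: unitary_def matrix_vector_mul_assoc)
  have gf: "par (g y) (adjoint_mat U *v f y)" if "y \<noteq> 0" for y
  proof -
    have "par (adjoint_mat U *v f y) (adjoint_mat U *v (M *v g y))" using Mg[OF that] by (rule par_mult_vec)
    then have "par (adjoint_mat U *v f y) (k *s g y)" by (simp add: MU msmul_mult_vec mult_vec_smult UU)
    then show ?thesis using par_smult[OF k] par_sym par_trans by blast
  qed
  \<comment> \<open>The adjoint of \<open>U\<close> carries the line of \<open>f y\<close> to that
    of \<open>g y\<close>, so \<open>f\<close> replaces \<open>g\<close> in the intertwining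
    relation.\<close>
  define \<Psi> where "\<Psi> B = \<Phi> B ** adjoint_mat U" for B
  have \<Psi>f: "par (\<Phi> B *v g y) (\<Psi> B *v f y)" if "y \<noteq> 0" for B y
    using par_mult_vec[OF gf[OF that], of "\<Phi> B"] by (simp add: \<Psi>_def matrix_vector_mul_assoc)
  interpret orth_projective_map f \<Psi>
  proof
    fix y :: "complex^'n" and B :: "complex^'n^'n" assume y: "y \<noteq> 0"
    { assume "B *v y = 0"
      then show "\<Psi> B *v f y = 0" using int0[OF y] \<Psi>f[OF y] par_eq_0 by blast }
    { assume "B *v y \<noteq> 0"
      then show "par (f (B *v y)) (\<Psi> B *v f y)" using int[OF y] \<Psi>f[OF y] par_trans by blast }
  qed (use dim f_nz f_surj f_orth in auto)
  obtain T h where h: "h = (\<lambda>z. z) \<or> h = cnj" and T: "\<And>x. x \<noteq> 0 \<Longrightarrow> par (f x) (T *v hvec h x)"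
    using representation by blast
  note hs = hvec_simps[OF h]
  have "cinner (T *v p) (T *v q) = 0" if pq: "cinner p q = 0" for p q
  proof (cases "p = 0 \<or> q = 0")
    case False
    define x y where "x = hvec h p" and "y = hvec h q"
    have xy: "x \<noteq> 0" "y \<noteq> 0" "cinner x y = 0" "hvec h x = p" "hvec h y = q"
      using False pq by (auto simp: x_def y_def hs)
    then show ?thesis
      using par_cinner_eq_0[OF T[OF xy(1)] T[OF xy(2)]] f_orth[OF xy(1,2)] by simp
  qed (auto simp: cinner_simps)
  moreover have "T \<noteq> 0" using T[OF e] f_nz[OF e] par_eq_0 by fastforce
  ultimately obtain m V where m: "m \<noteq> 0" and V: "unitary V" and TV: "T = msmul m V"
    using orth_preserving_matrix by blast
  have fV: "par (f x) (V *v hvec h x)" if "x \<noteq> 0" for x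
    using T[OF that] par_smult[OF m, of "V *v hvec h x"] par_sym par_trans
    unfolding TV msmul_mult_vec by blast
  \<comment> \<open>On lines \<open>f\<close> is \<open>V\<close> after \<open>hvec h\<close>, and
    \<open>g\<close> is \<open>adjoint_mat U ** V\<close> after \<open>hvec h\<close>; this
    \<open>L\<close> satisfies \<open>rel\<close> for exactly these two maps.\<close>
  define L where "L X = V ** hmat h X ** (adjoint_mat V ** U)" for X
  have "\<exists>c. c \<noteq> 0 \<and> \<Phi> B = msmul c (L B)" for B
  proof -
    \<comment> \<open>Undoing the unitaries of \<open>L\<close> on \<open>\<Phi> B\<close> gives a
      matrix to be compared with \<open>hmat h B\<close> through zeros alone.\<close>
    define Q where "Q = adjoint_mat V ** \<Phi> B ** (adjoint_mat U ** V)"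
    have "cinner x (hmat h B *v y) = 0 \<longleftrightarrow> cinner x (Q *v y) = 0" for x y
    proof (cases "x = 0 \<or> y = 0")
      case False
      define x' y' where "x' = hvec h x" and "y' = hvec h y"
      have xy: "x' \<noteq> 0" "y' \<noteq> 0" "hvec h x' = x" "hvec h y' = y"
        using False by (auto simp: x'_def y'_def hs)
      have "cinner x (hmat h B *v y) = h (cinner x' (B *v y'))"
        by (simp add: hs flip: xy(3,4))
      then have "cinner x (hmat h B *v y) = 0 \<longleftrightarrow> cinner (f x') (\<Phi> B *v g y') = 0"
        using hs rel[OF xy(1,2)] by simp
      also have "\<dots> \<longleftrightarrow> cinner (V *v x) (\<Phi> B *v (adjoint_mat U *v (V *v y))) = 0"
      proof (rule par_cinner_eq_0)
        show "par (f x') (V *v x)" using fV[OF xy(1)] xy(3) by simp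
        have "par (g y') (adjoint_mat U *v (V *v y))"
          using gf[OF xy(2)] par_mult_vec[OF fV[OF xy(2)]] xy(4) par_trans by metis
        then show "par (\<Phi> B *v g y') (\<Phi> B *v (adjoint_mat U *v (V *v y)))" by (rule par_mult_vec)
      qed
      also have "\<dots> \<longleftrightarrow> cinner x (Q *v y) = 0"
        by (simp add: Q_def cinner_adjoint_left flip: matrix_vector_mul_assoc)
      finally show ?thesis .
    qed (auto simp: cinner_simps)
    then obtain c where c: "c \<noteq> 0" "Q = msmul c (hmat h B)" using zeros_determine_matrix by blast
    have VV: "V *v (adjoint_mat V *v x) = x" and UU': "U *v (adjoint_mat U *v x) = x" for x
      using unitary_mult_adjoint[OF V] unitary_mult_adjoint[OF U] by (simp_all add: matrix_vector_mul_assoc)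
    have "\<Phi> B *v x = msmul c (L B) *v x" for x
    proof -
      have "msmul c (L B) *v x = V *v (Q *v (adjoint_mat V *v (U *v x)))"
        by (simp add: c(2) L_def msmul_mult_vec mult_vec_smult flip: matrix_vector_mul_assoc)
      also have "\<dots> = \<Phi> B *v x" by (simp add: Q_def VV UU flip: matrix_vector_mul_assoc)
      finally show ?thesis by simp
    qed
    then have "\<Phi> B = msmul c (L B)" by (rule matrix_eqI_vec)
    then show ?thesis using c(1) by blast
  qed
  moreover have "L (X + Y) = L X + L Y" for X Y
  proof -
    have "hmat h (X + Y) = hmat h X + hmat h Y" using h by (auto simp: hmat_def vec_eq_iff)
    then show ?thesis
      by (intro matrix_eqI_vec)
        (simp add: L_def matrix_vector_mult_add_rdistrib matrix_vector_right_distrib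
          flip: matrix_vector_mul_assoc)
  qed
  moreover have "opnorm (L X) = opnorm X" for X
    unfolding L_def
    by (simp add: opnorm_unitary_left opnorm_unitary_right unitary_mult unitary_adjoint U V opnorm_hmat h)
  moreover have L_msmul: "L (msmul c X) = msmul (h c) (L X)" for c X
  proof -
    have "hmat h (msmul c X) = msmul (h c) (hmat h X)" using h by (auto simp: hmat_def msmul_def vec_eq_iff)
    then show ?thesis
      by (intro matrix_eqI_vec) (simp add: L_def msmul_mult_vec mult_vec_smult flip: matrix_vector_mul_assoc)
  qed
  have "(\<forall>c X. L (msmul c X) = msmul c (L X)) \<or> (\<forall>c X. L (msmul c X) = msmul (cnj c) (L X))"
    using h L_msmul by auto
  ultimately show ?thesis
    unfolding proportional_to_isometry_def by (intro exI[of _ L] conjI allI) blast+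
qed

text \<open>If rows go to columns, compose with the adjoint.\<close>

lemma proportional_to_isometry: "proportional_to_isometry \<Phi>"
proof (cases "\<forall>x y y'. x \<noteq> 0 \<and> y \<noteq> 0 \<and> y' \<noteq> 0 \<longrightarrow> par (lft x y) (lft x y')")
  case True
  then show ?thesis by (intro row_preserving_proportional_to_isometry) blast
next
  case False
  then have cols: "par (rgt x y) (rgt x y')" if "x \<noteq> 0" "y \<noteq> 0" "y' \<noteq> 0" for x y y'
    using rows_uniform that by blast
  let ?\<Phi> = "\<lambda>X. adjoint_mat (\<Phi> X)"
  interpret adj: bj_isomorphism ?\<Phi> by (rule bj_isomorphism_adjoint)
  have "proportional_to_isometry ?\<Phi>"
  proof (rule adj.row_preserving_proportional_to_isometry)
    fix x y y' :: "complex^'n" assume nz: "x \<noteq> 0" "y \<noteq> 0" "y' \<noteq> 0"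
    \<comment> \<open>Taking adjoints exchanges the factors. The factors of the composed map come
      from a separate choice, so they agree with the old ones only up to scalars.\<close>
    have p: "par (adj.lft x z) (rgt x z)" if "z \<noteq> 0" for z
    proof -
      have "rank_one (adj.lft x z) (adj.rgt x z) = rank_one (rgt x z) (lft x z)"
        using adj.image_rank_one(3)[OF nz(1) that] image_rank_one(3)[OF nz(1) that]
        by (simp add: adjoint_rank_one)
      then have "same_orth (rank_one (adj.lft x z) (adj.rgt x z)) (rank_one (rgt x z) (lft x z))"
        by (simp add: same_orth_def)
      then show ?thesis
        using same_orth_rank_one[OF adj.image_rank_one(1,2)[OF nz(1) that] image_rank_one(2,1)[OF nz(1) that]]
        by simp
    qed
    show "par (adj.lft x y) (adj.lft x y')"
      using par_trans[OF par_trans[OF p[OF nz(2)] cols[OF nz]] par_sym[OF p[OF nz(3)]]] .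
  qed
  then show ?thesis by (rule proportional_to_isometry_adjoint)
qed

end

theorem theorem1p2:
  fixes \<Phi> :: "complex^'n^'n \<Rightarrow> complex^'n^'n"
  assumes "CARD('n) \<ge> 2"
    and "bij \<Phi>"
    and "\<forall>A B. bj_orth A B \<longleftrightarrow> bj_orth (\<Phi> A) (\<Phi> B)"
  shows "\<exists>\<gamma> :: complex^'n^'n \<Rightarrow> complex.
           (\<forall>X. \<gamma> X \<noteq> 0) \<and>
           (let \<Psi> = (\<lambda>X. msmul (\<gamma> X) (\<Phi> X)) in
              (\<forall>X Y. \<Psi> (X + Y) = \<Psi> X + \<Psi> Y) \<and>
              ((\<forall>c X. \<Psi> (msmul c X) = msmul c (\<Psi> X)) \<or>
               (\<forall>c X. \<Psi> (msmul c X) = msmul (cnj c) (\<Psi> X))) \<and>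
              (\<forall>X. opnorm (\<Psi> X) = opnorm X))"
proof -
  interpret bj_isomorphism \<Phi> using assms by unfold_locales auto
  obtain L where L: "\<forall>X Y. L (X + Y) = L X + L Y"
    "(\<forall>c X. L (msmul c X) = msmul c (L X)) \<or> (\<forall>c X. L (msmul c X) = msmul (cnj c) (L X))"
    "\<forall>X. opnorm (L X) = opnorm X" "\<forall>X. \<exists>c. c \<noteq> 0 \<and> \<Phi> X = msmul c (L X)"
    using proportional_to_isometry unfolding proportional_to_isometry_def by blast
  obtain c where c: "\<And>X. c X \<noteq> 0" "\<And>X. \<Phi> X = msmul (c X) (L X)" using L(4) by metis
  have "msmul (1 / c X) (\<Phi> X) = L X" for X using c(1)[of X] by (subst c(2)) (simp add: msmul_msmul)
  then show ?thesis using L c(1) by (intro exI[of _ "\<lambda>X. 1 / c X"]) (simp add: Let_def)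
qed

end
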